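(* Let $\mathbf{B}\succ 0$ and $\mathbf{Q}\succ 0$ be $n\times n$ matrices. Assume that $f:\mathbb{R}^n\to\mathbb{R}$ is $\mathbf{Q}$-smooth with respect to $\mathbf{B}$ and $\mu$-strongly convex (with $\mu>0$, with respect to $\langle\cdot,\cdot\rangle_{\mathbf B}$), and let $R:\mathbb{R}^n\to\mathbb{R}\cup\{+\infty\}$ be closed and convex, $F=f+R$. Let $\mathbf{C}=\mathbb{E}_{\mathcal D}[\theta_k^2\mathbf{Z}_k]$. Choose a stepsize $\alpha>0$ and a parameter $\sigma>0$ such that, in the Loewner order, $$\alpha\left(2(\mathbf{C}-\mathbf{B})+\sigma\mu\mathbf{B}\right)\preceq \sigma\,\mathbb{E}_{\mathcal D}[\mathbf{Z}],\qquad \alpha\mathbf{C}\preceq \tfrac12\left(\mathbf{Q}-\sigma\,\mathbb{E}_{\mathcal D}[\mathbf{Z}]\right).$$ Fix $x^0,h^0\in\mathrm{dom}(F)$ and let $x^k,h^k$ be the random iterates produced by the SEGA algorithm. Then for all $k\ge 0$ $$\mathbb{E}[\Phi^k]\le(1-\alpha\mu)^k\Phi^0,$$ where $\Phi^k=\|x^k-x^*\|_{\mathbf B}^2+\sigma\alpha\|h^k-\nabla f(x^* )\|_{\mathbf B}^2$ and $x^*$ is the solution of $\min_{x\in\mathbb{R}^n}F(x)$.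
   Context: Notation: $\langle x,y\rangle_{\mathbf B}=x^\top\mathbf{B}y$; for a symmetric matrix $\mathbf W$, $\|x\|_{\mathbf W}^2=x^\top\mathbf{W}x$; $\dagger$ is the Moore–Penrose pseudoinverse. $\nabla f$ denotes the gradient with respect to the inner product $\langle\cdot,\cdot\rangle_{\mathbf B}$, i.e. $f(x+d)=f(x)+\langle\nabla f(x),d\rangle_{\mathbf B}+o(\|d\|)$. $f$ is $\mu$-strongly convex if $f(x)\ge f(y)+\langle\nabla f(y),x-y\rangle_{\mathbf B}+\frac{\mu}{2}\|x-y\|_{\mathbf B}^2$ for all $x,y\in\mathbb{R}^n$. $f$ is $\mathbf Q$-smooth with respect to $\mathbf B$ if $f(x)-f(y)-\langle\nabla f(y),x-y\rangle_{\mathbf B}\ge\frac12\|\nabla f(x)-\nabla f(y)\|_{\mathbf Q}^2$ for all $x,y$. $\mathrm{prox}_{\alpha R}(x)=\arg\min_{y}\{R(y)+\frac{1}{2\alpha}\|y-x\|_{\mathbf B}^2\}$. $\mathcal D$ is a probability distribution over matrices $\mathbf S$ with $n$ rows; $\mathbb{E}_{\mathcal D}$ is expectation over $\mathbf S\sim\mathcal D$. For $\mathbf S_k\sim\mathcal D$ put $\mathbf Z_k=\mathbf S_k(\mathbf S_k^\top\mathbf B^{-1}\mathbf S_k)^\dagger\mathbf S_k^\top$ ($\mathbf Z$ denotes a generic copy). $\theta_k=\theta(\mathbf S_k)$ is a real random variable, assumed to exist, with $\mathbb{E}_{\mathcal D}[\theta_k\mathbf Z_k]=\mathbf B$ (and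 $\mathbb{E}_{\mathcal D}[\theta_k^2\mathbf Z_k]$ finite). SEGA algorithm: for $k=0,1,2,\dots$, sample $\mathbf S_k\sim\mathcal D$ independently of the past and set $g^k=h^k+\theta_k\mathbf B^{-1}\mathbf Z_k(\nabla f(x^k)-h^k)$, $\;x^{k+1}=\mathrm{prox}_{\alpha R}(x^k-\alpha g^k)$, $\;h^{k+1}=h^k+\mathbf B^{-1}\mathbf Z_k(\nabla f(x^k)-h^k)$. *)

theory Defs
  imports "HOL-Probability.Probability" "Jordan_Normal_Form.Matrix"
begin

(* Both libraries use these two symbols; they are kept for inner and vec_nth only. *)
no_notation scalar_prod (infix \<open>\<bullet>\<close> 70)
no_notation vec_index (infixl \<open>$\<close> 100)

definition binner :: "real^'n^'n \<Rightarrow> real^'n \<Rightarrow> real^'n \<Rightarrow> real" where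
  "binner B x y = x \<bullet> (B *v y)"

(* The squared (semi)norm of x with respect to W. *)
definition normsq :: "real^'n^'n \<Rightarrow> real^'n \<Rightarrow> real" where
  "normsq W x = x \<bullet> (W *v x)"

definition pos_def :: "real^'n^'n \<Rightarrow> bool" where
  "pos_def A \<longleftrightarrow> transpose A = A \<and> (\<forall>x. x \<noteq> 0 \<longrightarrow> 0 < x \<bullet> (A *v x))"

definition pos_semidef :: "real^'n^'n \<Rightarrow> bool" where
  "pos_semidef A \<longleftrightarrow> transpose A = A \<and> (\<forall>x. 0 \<le> x \<bullet> (A *v x))"

definition loewner_le :: "real^'n^'n \<Rightarrow> real^'n^'n \<Rightarrow> bool" (infix \<open>\<preceq>\<^sub>L\<close> 50) where
  "A \<preceq>\<^sub>L A' \<longleftrightarrow> pos_semidef (A' - A)"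

(* The gradient with respect to the inner product given by B;
   meaningful where f is differentiable. *)
definition Bgrad :: "real^'n^'n \<Rightarrow> (real^'n \<Rightarrow> real) \<Rightarrow> real^'n \<Rightarrow> real^'n" where
  "Bgrad B f x = (THE g. (f has_derivative (\<lambda>d. binner B g d)) (at x))"

definition strongly_convex :: "real^'n^'n \<Rightarrow> real \<Rightarrow> (real^'n \<Rightarrow> real) \<Rightarrow> bool" where
  "strongly_convex B \<mu> f \<longleftrightarrow>
     (\<forall>x y. f x \<ge> f y + binner B (Bgrad B f y) (x - y) + \<mu> / 2 * normsq B (x - y))"

definition Q_smooth :: "real^'n^'n \<Rightarrow> real^'n^'n \<Rightarrow> (real^'n \<Rightarrow> real) \<Rightarrow> bool" where
  "Q_smooth B Q f \<longleftrightarrow>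
     (\<forall>x y. f x - f y - binner B (Bgrad B f y) (x - y)
              \<ge> 1 / 2 * normsq Q (Bgrad B f x - Bgrad B f y))"

(* The library constant epigraph is for real-valued functions only. *)
definition ereal_epigraph :: "('a \<Rightarrow> ereal) \<Rightarrow> ('a \<times> real) set" where
  "ereal_epigraph R = {(x, t). R x \<le> ereal t}"

definition closed_fun :: "('a::topological_space \<Rightarrow> ereal) \<Rightarrow> bool" where
  "closed_fun R \<longleftrightarrow> closed (ereal_epigraph R)"

definition convex_fun :: "('a::real_vector \<Rightarrow> ereal) \<Rightarrow> bool" where
  "convex_fun R \<longleftrightarrow> convex (ereal_epigraph R)"

definition eff_dom :: "('a \<Rightarrow> ereal) \<Rightarrow> 'a set" where
  "eff_dom F = {x. F x < \<infinity>}"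

definition prox :: "real^'n^'n \<Rightarrow> real \<Rightarrow> (real^'n \<Rightarrow> ereal) \<Rightarrow> real^'n \<Rightarrow> real^'n" where
  "prox B \<alpha> R x = arg_min (\<lambda>y. R y + ereal (1 / (2 * \<alpha>) * normsq B (y - x))) (\<lambda>_. True)"

(* The Moore-Penrose pseudoinverse. *)
definition pinv :: "real mat \<Rightarrow> real mat" where
  "pinv A = (THE X. X \<in> carrier_mat (dim_col A) (dim_row A)
      \<and> A * X * A = A \<and> X * A * X = X
      \<and> transpose_mat (A * X) = A * X \<and> transpose_mat (X * A) = X * A)"

(* A real matrix with rows indexed by 'n and an arbitrary number of columns, given as the
   list of its columns: the number of columns may vary with the random draw. *)
type_synonym 'n sketch = "(real^'n) list"

(* The Borel sigma-algebra on the disjoint union over b of the spaces of matrices with b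
   columns: the coarsest one making the number of columns and each column measurable. *)
definition sketch_space :: "('n::finite) sketch measure" where
  "sketch_space = vimage_algebra UNIV
     (\<lambda>S. (length S, \<lambda>j. if j < length S then S ! j else 0))
     (count_space UNIV \<Otimes>\<^sub>M (\<Pi>\<^sub>M j\<in>(UNIV :: nat set). (borel :: (real^'n) measure)))"

(* The matrix S^T B^-1 S. *)
definition sketch_gram :: "real^'n^'n \<Rightarrow> 'n sketch \<Rightarrow> real mat" where
  "sketch_gram B S = Matrix.mat (length S) (length S) (\<lambda>(i, j). S ! i \<bullet> (matrix_inv B *v S ! j))"

(* The matrix S (S^T B^-1 S)^+ S^T. *)
definition Zmat :: "real^'n^'n \<Rightarrow> 'n sketch \<Rightarrow> real^'n^'n" where
  "Zmat B S = (\<chi> r c. \<Sum>i<length S. \<Sum>j<length S.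
      S ! i $ r * pinv (sketch_gram B S) $$ (i, j) * S ! j $ c)"

(* The iterates (x^k, h^k) of SEGA as a function of the sequence of sampled sketches;
   only the first k sketches enter the k-th iterate. *)
primrec sega :: "real^'n^'n \<Rightarrow> (real^'n \<Rightarrow> real) \<Rightarrow> (real^'n \<Rightarrow> ereal) \<Rightarrow> real \<Rightarrow>
    ('n sketch \<Rightarrow> real) \<Rightarrow> real^'n \<Rightarrow> real^'n \<Rightarrow> (nat \<Rightarrow> 'n sketch) \<Rightarrow> nat \<Rightarrow>
    (real^'n) \<times> (real^'n)" where
  "sega B f R \<alpha> \<theta> x0 h0 S 0 = (x0, h0)"
| "sega B f R \<alpha> \<theta> x0 h0 S (Suc k) =
    (let (x, h) = sega B f R \<alpha> \<theta> x0 h0 S k;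
         u = matrix_inv B *v (Zmat B (S k) *v (Bgrad B f x - h));
         g = h + \<theta> (S k) *\<^sub>R u
     in (prox B \<alpha> R (x - \<alpha> *\<^sub>R g), h + u))"

definition lyapunov :: "real^'n^'n \<Rightarrow> (real^'n \<Rightarrow> real) \<Rightarrow> real \<Rightarrow> real \<Rightarrow> real^'n \<Rightarrow>
    (real^'n) \<times> (real^'n) \<Rightarrow> real" where
  "lyapunov B f \<alpha> \<sigma> xstar =
     (\<lambda>(x, h). normsq B (x - xstar) + \<sigma> * \<alpha> * normsq B (h - Bgrad B f xstar))"

end

theory Submission
  imports Defs "Jordan_Normal_Form.Gauss_Jordan_Elimination"
begin

text \<open>
Write \<open>r = x - x*\<close>, \<open>v = \<nabla>f(x) - \<nabla>f(x*)\<close> and \<open>w = h - \<nabla>f(x*)\<close> for the errors of a state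
\<open>(x, h)\<close>, and \<open>P = B\<inverse> Z\<close> for the random matrix of one step. Since \<open>Z\<close> is built from a
pseudoinverse, \<open>P\<close> is the \<open>B\<close>-orthogonal projection onto the column space of \<open>B\<inverse> S\<close>: \<open>Z\<close> is
symmetric and \<open>Z B\<inverse> Z = Z\<close>. Every second moment in one step therefore collapses to a quadratic
form of \<open>Z\<close>, \<open>\<theta> Z\<close> or \<open>\<theta>\<^sup>2 Z\<close>, whose expectations are given by the data of the problem.

The gradient estimate satisfies \<open>g - \<nabla>f(x*) = (w - \<theta> P w) + \<theta> P v\<close>. Its mean is \<open>v\<close>, because
\<open>\<theta> Z\<close> has mean \<open>B\<close>, and its second moment is at most twice the sum of the \<open>(C - B)\<close>-form of \<open>w\<close>
and the \<open>C\<close>-form of \<open>v\<close>. The new shift error is \<open>(I - P) w + P v\<close>, a sum of two orthogonal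
vectors, so its expected squared norm is the \<open>B\<close>-form of \<open>w\<close> minus the \<open>E[Z]\<close>-form of \<open>w\<close> plus
the \<open>E[Z]\<close>-form of \<open>v\<close>. The minimizer is a fixed point of the proximal gradient map and the
proximal operator is nonexpansive, so the new iterate is at most as far from \<open>x*\<close> as \<open>x - \<alpha> g\<close> is from
\<open>x* - \<alpha> \<nabla>f(x*)\<close>. Adding the strong convexity and the smoothness inequalities bounds the cross term
from below: \<open>2 <v, r> \<ge> \<mu> |r|\<^sup>2 + |v|\<^sup>2\<close> with the last norm taken with respect to \<open>Q\<close>
and the others with respect to \<open>B\<close>. The second stepsize condition makes
all terms in \<open>v\<close> nonpositive, the first one bounds the terms in \<open>w\<close> by \<open>(1 - \<alpha> \<mu>)\<close> times the
\<open>w\<close>-part of the Lyapunov function, and one step contracts that function in expectation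
(\<open>V_step_le\<close>, \<open>step_bound_contracts\<close>). As the current sketch is independent of the current state,
iterating gives the geometric rate.

Three facts make these expectations meaningful. The pseudoinverse exists (\<open>penrose_pinv\<close>). It is a
discontinuous function of the matrix, yet \<open>Z\<close> depends measurably on the sketch, because the
projection \<open>P\<close> can also be computed by the Gram-Schmidt process, which uses only arithmetic and one
division per column (\<open>measurable_Zmat\<close>). The proximal operator attains its minimum, because
optimality of \<open>x*\<close> provides an affine minorant of \<open>R\<close> (\<open>prox_objective_attains_min\<close>).
\<close>

(* Only inner and vec_nth are written with these two symbols below. *)
no_notation scalar_prod (infix \<open>\<bullet>\<close> 70)
no_notation vec_index (infixl \<open>$\<close> 100)

section \<open>The Moore-Penrose inverse of a real matrix\<close>

text \<open>
For a matrix in reduced row echelon form, sending the index of each nonzero row to its pivot column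
is a generalized inverse; undoing the row operations transports it to the original matrix.
\<close>
lemma generalized_inverse_exists:
  fixes A :: "'a :: field mat"
  assumes A: "A \<in> carrier_mat m n"
  obtains G where "G \<in> carrier_mat n m" "A * G * A = A"
proof -
  define C where "C = gauss_jordan_single A"
  note gj = gauss_jordan_single[OF A C_def[symmetric]]
  have C: "C \<in> carrier_mat m n" using gj(2) .
  obtain P P' where P: "P \<in> carrier_mat m m" "P' \<in> carrier_mat m m"
    and CPA: "C = P * A" and P'P: "P' * P = 1\<^sub>m m"
    using gj(4) by auto
  obtain f where f: "pivot_fun C f n"
    using gj(3) C unfolding row_echelon_form_def by auto
  have dC: "dim_row C = m" using C by simp
  note pf = pivot_funD[OF dC f]
  define E where "E = Matrix.mat n m (\<lambda>(j, i). if j = f i then 1 else 0 :: 'a)"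
  have E: "E \<in> carrier_mat n m" unfolding E_def by simp
  have CE: "C * E = Matrix.mat m m (\<lambda>(k, i). if k = i \<and> f i < n then 1 else 0)"
  proof (rule eq_matI)
    fix k i assume "k < dim_row (Matrix.mat m m (\<lambda>(k, i). if k = i \<and> f i < n then 1 else 0 :: 'a))"
      and "i < dim_col (Matrix.mat m m (\<lambda>(k, i). if k = i \<and> f i < n then 1 else 0 :: 'a))"
    then have k: "k < m" and i: "i < m" by auto
    have "(C * E) $$ (k, i) = (\<Sum>j<n. C $$ (k, j) * E $$ (j, i))"
      using C E k i by (simp add: scalar_prod_def atLeast0LessThan)
    also have "\<dots> = (\<Sum>j<n. if j = f i then C $$ (k, j) else 0)"
      using i by (intro sum.cong) (auto simp: E_def)
    also have "\<dots> = (if f i < n then C $$ (k, f i) else 0)"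
      by (simp add: sum.delta)
    also have "\<dots> = (if k = i \<and> f i < n then 1 else 0)"
      using pf(4)[OF i] pf(5)[OF i _ k] by auto
    finally show "(C * E) $$ (k, i)
        = Matrix.mat m m (\<lambda>(k, i). if k = i \<and> f i < n then 1 else 0) $$ (k, i)"
      using k i by simp
  qed (use C E in auto)
  have CEC: "C * E * C = C"
  proof (rule eq_matI)
    fix k l assume "k < dim_row C" "l < dim_col C"
    then have k: "k < m" and l: "l < n" using C by auto
    have "(C * E * C) $$ (k, l) = (\<Sum>i<m. (C * E) $$ (k, i) * C $$ (i, l))"
      using CE C k l index_mult_mat(1)[of k "C * E" l C]
      by (simp add: scalar_prod_def atLeast0LessThan)
    also have "\<dots> = (\<Sum>i<m. if i = k then (if f k < n then C $$ (k, l) else 0) else 0)"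
      unfolding CE using k by (intro sum.cong) auto
    also have "\<dots> = (if f k < n then C $$ (k, l) else 0)" using k by simp
    also have "\<dots> = C $$ (k, l)" using pf(1)[OF k] pf(2)[OF k, of l] l by auto
    finally show "(C * E * C) $$ (k, l) = C $$ (k, l)" .
  qed (use C E in auto)
  have "A = P' * C"
    using assoc_mult_mat[OF P(2) P(1) A] P'P A CPA by simp
  have "A * (E * P) * A = P' * (C * E * C)"
  proof -
    have "A * (E * P) * A = A * (E * C)"
      unfolding CPA using A E P by (simp add: assoc_mult_mat[of _ _ m _ m _ n] assoc_mult_mat[of _ n m _ m _ n] assoc_mult_mat[of _ m n _ m _ n] assoc_mult_mat[of _ m n _ n _ n])
    also have "\<dots> = P' * C * (E * C)" using \<open>A = P' * C\<close> by simp
    also have "\<dots> = P' * (C * E * C)"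
      using C E P by (simp add: assoc_mult_mat[of _ m m _ n _ n] assoc_mult_mat[of _ m n _ m _ n])
    finally show ?thesis .
  qed
  then have "A * (E * P) * A = A" using CEC \<open>A = P' * C\<close> by simp
  moreover have "E * P \<in> carrier_mat n m" using E P by simp
  ultimately show thesis using that by blast
qed

lemma mult_transpose_eq_0_imp_eq_0:
  fixes A :: "real mat"
  assumes A: "A \<in> carrier_mat m n" and 0: "transpose_mat A * A = 0\<^sub>m n n"
  shows "A = 0\<^sub>m m n"
proof (rule eq_matI)
  fix i j assume "i < dim_row (0\<^sub>m m n)" "j < dim_col (0\<^sub>m m n)"
  then have i: "i < m" and j: "j < n" by auto
  have "(\<Sum>k<m. A $$ (k, j) * A $$ (k, j)) = (transpose_mat A * A) $$ (j, j)"
    using A j by (simp add: scalar_prod_def atLeast0LessThan)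
  then have "(\<Sum>k<m. A $$ (k, j) * A $$ (k, j)) = 0" using 0 j by simp
  then have "A $$ (i, j) * A $$ (i, j) = 0"
    using i by (subst (asm) sum_nonneg_eq_0_iff) auto
  then show "A $$ (i, j) = 0\<^sub>m m n $$ (i, j)" using i j by simp
qed (use A in auto)

text \<open>
The matrices \<open>A\<^sup>T A\<close> and \<open>A\<close> have the same kernel over the reals: for \<open>M = A (X - Y)\<close> the hypothesis
gives \<open>M\<^sup>T M = 0\<close>, and the diagonal of \<open>M\<^sup>T M\<close> consists of sums of squares.
\<close>
lemma transpose_mult_cancel_left:
  fixes A :: "real mat"
  assumes A: "A \<in> carrier_mat m n" and X: "X \<in> carrier_mat n k" and Y: "Y \<in> carrier_mat n k"
    and eq: "transpose_mat A * A * X = transpose_mat A * A * Y"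
  shows "A * X = A * Y"
proof -
  let ?T = "transpose_mat A" and ?M = "A * X - A * Y"
  have T: "?T \<in> carrier_mat n m" using A by simp
  have AX: "A * X \<in> carrier_mat m k" and AY: "A * Y \<in> carrier_mat m k" using A X Y by auto
  have M: "?M \<in> carrier_mat m k" using AY by (rule minus_carrier_mat)
  have TM: "?T * ?M = 0\<^sub>m n k"
    unfolding mult_minus_distrib_mat[OF T AX AY]
      assoc_mult_mat[OF T A X, symmetric] assoc_mult_mat[OF T A Y, symmetric] eq
    by (rule minus_r_inv_mat[of _ n k]) (use T A Y in auto)
  have XY: "X - Y \<in> carrier_mat n k" using Y by (rule minus_carrier_mat)
  have "?M = A * (X - Y)" using mult_minus_distrib_mat[OF A X Y] by simp
  then have "transpose_mat ?M = transpose_mat (X - Y) * ?T"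
    using transpose_mult[OF A XY] by simp
  then have "transpose_mat ?M * ?M = transpose_mat (X - Y) * (?T * ?M)"
    using assoc_mult_mat[of "transpose_mat (X - Y)" k n ?T m ?M k] XY T M by simp
  also have "\<dots> = 0\<^sub>m k k" unfolding TM
    by (rule right_mult_zero_mat) (use XY in \<open>simp only: transpose_carrier_mat\<close>)
  finally have "?M = 0\<^sub>m m k" by (rule mult_transpose_eq_0_imp_eq_0[OF M])
  then have z: "\<And>i j. i < m \<Longrightarrow> j < k \<Longrightarrow> (A * X - A * Y) $$ (i, j) = 0" by simp
  show ?thesis
  proof (rule eq_matI)
    fix i j assume "i < dim_row (A * Y)" "j < dim_col (A * Y)"
    then have "i < m" "j < k" using A Y by auto
    then show "(A * X) $$ (i, j) = (A * Y) $$ (i, j)"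
      using z[of i j] AX AY A X Y by simp
  qed (use A X Y in auto)
qed

text \<open>
The defining property of the pseudoinverse, separated from the choice operator that selects it.
\<close>
definition penrose :: "real mat \<Rightarrow> real mat \<Rightarrow> bool" where
  "penrose A X \<longleftrightarrow> X \<in> carrier_mat (dim_col A) (dim_row A)
      \<and> A * X * A = A \<and> X * A * X = X
      \<and> transpose_mat (A * X) = A * X \<and> transpose_mat (X * A) = X * A"

text \<open>
The matrix \<open>E\<close> is a projection onto the range of \<open>A\<close> that vanishes on its orthogonal complement,
hence the orthogonal one. In matrix terms \<open>E E\<^sup>T = E\<^sup>T\<close>, and the left side is symmetric.
\<close>
lemma symmetric_if_range_kernel:
  fixes A :: "real mat"
  assumes A: "A \<in> carrier_mat m n" and L: "L \<in> carrier_mat m n"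
    and E: "E = L * transpose_mat A" and EA: "E * A = A"
  shows "transpose_mat E = E"
proof -
  let ?T = "transpose_mat"
  have Ec: "E \<in> carrier_mat m m" unfolding E using A L by simp
  have ET: "?T E = A * ?T L" unfolding E using transpose_mult[of L m n "?T A" m] A L by simp
  have "E * ?T E = (E * A) * ?T L" unfolding ET
    using assoc_mult_mat[OF Ec A, of "?T L" m] L by simp
  then have 1: "E * ?T E = ?T E" unfolding EA ET .
  have "?T (E * ?T E) = E * ?T E" using transpose_mult[OF Ec, of "?T E" m] Ec by simp
  then show ?thesis unfolding 1 by simp
qed

text \<open>
Zlobec's formula \<open>A\<^sup>T G A\<^sup>T\<close>, where \<open>G\<close> is any generalized inverse of \<open>A\<^sup>T A A\<^sup>T\<close>: the factors
\<open>A\<^sup>T\<close> on both sides give the right range and kernel, so an arbitrary \<open>G\<close> suffices.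
\<close>
lemma penrose_exists:
  fixes A :: "real mat"
  shows "\<exists>X. penrose A X"
proof -
  define m n where "m = dim_row A" and "n = dim_col A"
  have A: "A \<in> carrier_mat m n" by (simp add: m_def n_def)
  define T where "T = transpose_mat A"
  have T: "T \<in> carrier_mat n m" and TT: "transpose_mat T = A" using A by (simp_all add: T_def)
  have K: "T * A * T \<in> carrier_mat n m" using A T by simp
  obtain G where G: "G \<in> carrier_mat m n" and KGK: "T * A * T * G * (T * A * T) = T * A * T"
    using generalized_inverse_exists[OF K] .
  define X where "X = T * G * T"
  have X: "X \<in> carrier_mat n m" unfolding X_def using T G by simp
  note assoc = assoc_mult_mat[of _ m n _ m _ n] assoc_mult_mat[of _ m n _ m _ m]
    assoc_mult_mat[of _ m n _ n _ n] assoc_mult_mat[of _ m n _ n _ m]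
    assoc_mult_mat[of _ n m _ n _ n] assoc_mult_mat[of _ n m _ n _ m]
    assoc_mult_mat[of _ n m _ m _ n] assoc_mult_mat[of _ n m _ m _ m]
    assoc_mult_mat[of _ m m _ m _ n] assoc_mult_mat[of _ m m _ m _ m]
    assoc_mult_mat[of _ m m _ n _ n] assoc_mult_mat[of _ m m _ n _ m]
    assoc_mult_mat[of _ n n _ n _ n] assoc_mult_mat[of _ n n _ n _ m]
    assoc_mult_mat[of _ n n _ m _ n] assoc_mult_mat[of _ n n _ m _ m]
  \<comment> \<open>Cancel the outer transposes, on the left and then, after transposing, on the right.\<close>
  have "T * A * (T * G * (T * A * T)) = T * A * T"
    using KGK A T G by (simp add: assoc)
  then have 1: "A * (T * G * (T * A * T)) = A * T"
    by (intro transpose_mult_cancel_left[OF A _ T, folded T_def]) (use A T G in auto)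
  let ?Y = "A * X"
  have Yc: "?Y \<in> carrier_mat m m" using A X by simp
  have "?Y * (A * T) = A * T"
    using 1 A T G unfolding X_def by (simp add: assoc)
  then have "transpose_mat (?Y * (A * T)) = transpose_mat (A * T)" by simp
  moreover have "transpose_mat (A * T) = A * T"
    using transpose_mult[OF A T] TT by (simp add: T_def)
  moreover have "transpose_mat (?Y * (A * T)) = A * T * transpose_mat ?Y"
    using transpose_mult[OF Yc, of "A * T" m] A T calculation(2) by simp
  ultimately have "transpose_mat T * T * transpose_mat ?Y = transpose_mat T * T * 1\<^sub>m m"
    using A T TT by simp
  then have "T * transpose_mat ?Y = T * 1\<^sub>m m"
    by (rule transpose_mult_cancel_left[OF T, rotated 2]) (use Yc in auto)
  then have "transpose_mat (?Y * A) = transpose_mat A"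
    using transpose_mult[OF Yc A] T by (simp add: T_def)
  then have AXA: "A * X * A = A" by (metis transpose_transpose)
  have S1: "transpose_mat (A * X) = A * X"
    by (rule symmetric_if_range_kernel[OF A, of "A * T * G"])
       (use A T G AXA in \<open>auto simp: X_def T_def[symmetric] assoc\<close>)
  have S2': "transpose_mat (transpose_mat (X * A)) = transpose_mat (X * A)"
  proof (rule symmetric_if_range_kernel[OF T, of "T * A * transpose_mat G"])
    show "T * A * transpose_mat G \<in> carrier_mat n m" using A T G by simp
    have "transpose_mat X = A * transpose_mat G * A"
      unfolding X_def using transpose_mult[of "T * G" n n T m] transpose_mult[of T n m G n] A T G TT
      by (simp add: assoc)
    then show "transpose_mat (X * A) = T * A * transpose_mat G * transpose_mat T"
      using transpose_mult[of X n m A n] A T G X TT by (simp add: T_def[symmetric] assoc)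
    show "transpose_mat (X * A) * T = T"
      using arg_cong[OF AXA, of transpose_mat] transpose_mult[of A m n "X * A" n] A X
      by (simp add: assoc T_def)
  qed
  then have S2: "transpose_mat (X * A) = X * A" by simp
  have "X * A * T = T"
    using arg_cong[OF AXA, of transpose_mat] transpose_mult[of A m n "X * A" n] A X S2
    by (simp add: assoc T_def)
  then have "X * A * (T * (G * T)) = T * (G * T)"
    using assoc_mult_mat[of "X * A" n n T m "G * T" m] A X T G by simp
  then have "X * A * X = X" unfolding X_def using T G by (simp add: assoc)
  then show ?thesis unfolding penrose_def using AXA S1 S2 X by (auto simp: m_def n_def)
qed

text \<open>
Both products are the orthogonal projection onto the range of \<open>A\<close>.
\<close>
lemma penrose_mult_eq:
  assumes X: "penrose A X" and Y: "penrose A Y"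
  shows "A * X = A * Y"
proof -
  define m n where "m = dim_row A" and "n = dim_col A"
  have A: "A \<in> carrier_mat m n" by (simp add: m_def n_def)
  have Xc: "X \<in> carrier_mat n m" and Yc: "Y \<in> carrier_mat n m"
    using X Y by (simp_all add: penrose_def m_def n_def)
  have c: "A * X \<in> carrier_mat m m" "A * Y \<in> carrier_mat m m" using A Xc Yc by auto
  have "A * X = (A * Y * A) * X" using Y by (simp add: penrose_def)
  also have "\<dots> = (A * Y) * (A * X)" by (rule assoc_mult_mat[OF c(2) A Xc])
  also have "\<dots> = transpose_mat (A * Y) * transpose_mat (A * X)"
    using X Y by (simp add: penrose_def)
  also have "\<dots> = transpose_mat ((A * X) * (A * Y))"
    by (rule transpose_mult[OF c, symmetric])
  also have "(A * X) * (A * Y) = (A * X * A) * Y" by (rule assoc_mult_mat[OF c(1) A Yc, symmetric])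
  also have "transpose_mat \<dots> = A * Y" using X Y by (simp add: penrose_def)
  finally show ?thesis .
qed

lemma penrose_transpose:
  assumes "penrose A X"
  shows "penrose (transpose_mat A) (transpose_mat X)"
proof -
  define m n where "m = dim_row A" and "n = dim_col A"
  have A: "A \<in> carrier_mat m n" by (simp add: m_def n_def)
  have X: "X \<in> carrier_mat n m"
    using assms by (simp add: penrose_def m_def n_def)
  have AX: "A * X \<in> carrier_mat m m" and XA: "X * A \<in> carrier_mat n n" using A X by auto
  have 1: "transpose_mat A * transpose_mat X = X * A"
    using transpose_mult[OF X A] assms by (simp add: penrose_def)
  have 2: "transpose_mat X * transpose_mat A = A * X"
    using transpose_mult[OF A X] assms by (simp add: penrose_def)
  have 3: "transpose_mat (A * X * A) = X * A * transpose_mat A"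
    using transpose_mult[OF A XA] assoc_mult_mat[OF A X A] assms by (simp add: penrose_def)
  have 4: "transpose_mat (X * A * X) = A * X * transpose_mat X"
    using transpose_mult[OF X AX] assoc_mult_mat[OF X A X] assms by (simp add: penrose_def)
  show ?thesis
    unfolding penrose_def 1 2 3[symmetric] 4[symmetric] using assms A X by (simp add: penrose_def)
qed

lemma penrose_unique:
  assumes X: "penrose A X" and Y: "penrose A Y"
  shows "X = Y"
proof -
  have A: "A \<in> carrier_mat (dim_row A) (dim_col A)" by simp
  have Xc: "X \<in> carrier_mat (dim_col A) (dim_row A)" and Yc: "Y \<in> carrier_mat (dim_col A) (dim_row A)"
    using X Y by (simp_all add: penrose_def)
  have "transpose_mat (X * A) = transpose_mat (Y * A)"
    using penrose_mult_eq[OF penrose_transpose[OF X] penrose_transpose[OF Y]]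
    by (simp only: transpose_mult[OF Xc A] transpose_mult[OF Yc A])
  then have YA: "X * A = Y * A" using X Y by (simp add: penrose_def)
  have "X = (X * A) * X" using X by (simp add: penrose_def)
  also have "\<dots> = Y * (A * X)" unfolding YA by (rule assoc_mult_mat[OF Yc A Xc])
  also have "\<dots> = Y * (A * Y)" unfolding penrose_mult_eq[OF X Y] ..
  also have "\<dots> = Y" using assoc_mult_mat[OF Yc A Yc] Y by (simp add: penrose_def)
  finally show ?thesis .
qed

text \<open>
This discharges the definite description in the definition of \<^const>\<open>pinv\<close>.
\<close>
lemma penrose_pinv: "penrose A (pinv A)"
proof -
  have "\<exists>!X. penrose A X" using penrose_exists penrose_unique by blast
  from theI'[OF this] show ?thesis unfolding pinv_def penrose_def .
qed

lemma transpose_pinv_symmetric: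
  assumes "transpose_mat A = A"
  shows "transpose_mat (pinv A) = pinv A"
  using penrose_unique[OF penrose_transpose[OF penrose_pinv[of A], unfolded assms] penrose_pinv[of A]] .

section \<open>Sketched projections\<close>

lemma inner_matrix_transpose: "x \<bullet> (A *v y) = (transpose A *v x) \<bullet> (y :: real^'n)" for A :: "real^'n^'n"
  by (simp add: dot_lmul_matrix)

lemma inner_symmetric_matrix:
  fixes A :: "real^'n^'n"
  assumes "transpose A = A"
  shows "x \<bullet> (A *v y) = (A *v x) \<bullet> y"
  using inner_matrix_transpose[of x A y] assms by simp

context
  fixes B :: "real^'n^'n"
  assumes B: "pos_def B"
begin

lemma pos_def_inverse: "matrix_inv B ** B = Finite_Cartesian_Product.mat 1" "B ** matrix_inv B = Finite_Cartesian_Product.mat 1"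
proof -
  have "x = 0" if "B *v x = 0" for x
    using B that unfolding pos_def_def by (metis inner_zero_right less_irrefl)
  then have "inj ((*v) B)"
    by (intro linear_injective_0[OF matrix_vector_mul_linear, THEN iffD2] allI impI)
  then have "invertible B"
    using matrix_left_invertible_injective invertible_left_inverse by blast
  then have "B ** matrix_inv B = Finite_Cartesian_Product.mat 1 \<and> matrix_inv B ** B = Finite_Cartesian_Product.mat 1"
    unfolding invertible_def matrix_inv_def by (rule someI_ex)
  then show "matrix_inv B ** B = Finite_Cartesian_Product.mat 1" "B ** matrix_inv B = Finite_Cartesian_Product.mat 1"
    by auto
qed

lemma inverse_apply [simp]: "matrix_inv B *v (B *v x) = x" "B *v (matrix_inv B *v x) = x"
  by (simp_all add: matrix_vector_mul_assoc pos_def_inverse)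

lemma transpose_pos_def: "transpose B = B"
  using B by (simp add: pos_def_def)

lemma inner_inverse: "x \<bullet> (matrix_inv B *v y) = (matrix_inv B *v x) \<bullet> y"
  using inner_symmetric_matrix[OF transpose_pos_def, of "matrix_inv B *v x" "matrix_inv B *v y"] by simp

lemma inverse_definite: "x \<bullet> (matrix_inv B *v x) = 0 \<longleftrightarrow> x = 0"
proof
  assume "x \<bullet> (matrix_inv B *v x) = 0"
  then have "(matrix_inv B *v x) \<bullet> (B *v (matrix_inv B *v x)) = 0"
    by (simp add: inner_commute)
  then have "matrix_inv B *v x = 0" using B unfolding pos_def_def by (metis less_irrefl)
  then have "B *v (matrix_inv B *v x) = 0" by simp
  then show "x = 0" by simp
qed simp

lemma Zmat_apply:
  "Zmat B S *v x = (\<Sum>i<length S. (\<Sum>j<length S. pinv (sketch_gram B S) $$ (i, j) * (S ! j \<bullet> x)) *\<^sub>R S ! i)"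
proof (rule Finite_Cartesian_Product.vec_eq_iff[THEN iffD2], rule allI)
  fix r
  have "(Zmat B S *v x) $ r = (\<Sum>c\<in>UNIV. \<Sum>i<length S. \<Sum>j<length S.
      S ! i $ r * pinv (sketch_gram B S) $$ (i, j) * S ! j $ c * x $ c)"
    by (simp add: Zmat_def matrix_vector_mult_def sum_distrib_right)
  also have "\<dots> = (\<Sum>i<length S. \<Sum>j<length S. \<Sum>c\<in>UNIV.
      S ! i $ r * pinv (sketch_gram B S) $$ (i, j) * S ! j $ c * x $ c)"
    by (subst sum.swap, rule sum.cong[OF refl], subst sum.swap, rule refl)
  also have "\<dots> = (\<Sum>i<length S. (\<Sum>j<length S. pinv (sketch_gram B S) $$ (i, j) * (S ! j \<bullet> x)) *\<^sub>R S ! i) $ r"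
    by (simp add: inner_vec_def sum_distrib_left sum_distrib_right mult_ac)
  finally show "(Zmat B S *v x) $ r = \<dots>" .
qed

lemma gram_carrier: "sketch_gram B S \<in> carrier_mat (length S) (length S)"
  by (simp add: sketch_gram_def)

lemma transpose_gram: "transpose_mat (sketch_gram B S) = sketch_gram B S"
proof (rule eq_matI)
  fix i j assume "i < dim_row (sketch_gram B S)" "j < dim_col (sketch_gram B S)"
  then show "transpose_mat (sketch_gram B S) $$ (i, j) = sketch_gram B S $$ (i, j)"
    using inner_inverse[of "S ! j" "S ! i"] by (simp add: sketch_gram_def inner_commute)
qed (simp_all add: sketch_gram_def)

lemma pinv_gram_carrier: "pinv (sketch_gram B S) \<in> carrier_mat (length S) (length S)"
  using penrose_pinv[of "sketch_gram B S"] gram_carrier[of S] by (simp add: penrose_def)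

text \<open>
The columns of \<open>B\<inverse> S\<close> are fixed by the projection. With \<open>A = S\<^sup>T B\<inverse> S\<close> and its pseudoinverse \<open>X\<close>, the
difference of the two sides is a column \<open>d\<close> of \<open>S (X A - I)\<close>; since \<open>A (X A - I) = 0\<close>, the
\<open>B\<inverse>\<close>-norm of \<open>d\<close> vanishes.
\<close>
lemma Zmat_inverse_column:
  assumes l: "l < length S"
  shows "Zmat B S *v (matrix_inv B *v S ! l) = S ! l"
proof -
  define A X m where "A = sketch_gram B S" and "X = pinv A" and "m = length S"
  have A: "A \<in> carrier_mat m m" unfolding A_def m_def by (rule gram_carrier)
  have X: "X \<in> carrier_mat m m" unfolding A_def X_def m_def by (rule pinv_gram_carrier)
  have Aij: "A $$ (i, j) = S ! i \<bullet> (matrix_inv B *v S ! j)" if "i < m" "j < m" for i j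
    using that by (simp add: A_def sketch_gram_def m_def)
  have AXA: "A * (X * A) = A"
    using penrose_pinv[of A] assoc_mult_mat[OF A X A] by (simp add: penrose_def X_def)
  have XA: "X * A \<in> carrier_mat m m" using A X by simp
  define c where "c i = (X * A) $$ (i, l) - (if i = l then 1 else 0)" for i
  define d where "d = (\<Sum>i<m. c i *\<^sub>R S ! i)"
  have lm: "l < m" using l by (simp add: m_def)
  have XAil: "(X * A) $$ (i, l) = (\<Sum>j<m. X $$ (i, j) * A $$ (j, l))" if "i < m" for i
    using A X that lm by (simp add: scalar_prod_def atLeast0LessThan)
  have "Zmat B S *v (matrix_inv B *v S ! l) = (\<Sum>i<m. (X * A) $$ (i, l) *\<^sub>R S ! i)"
    unfolding Zmat_apply X_def[symmetric] A_def[symmetric] m_def[symmetric]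
    using lm by (intro sum.cong) (simp_all add: Aij XAil)
  also have "\<dots> = d + S ! l"
    using lm by (simp add: d_def c_def scaleR_left_diff_distrib sum_subtractf if_distrib[of "\<lambda>a. a *\<^sub>R _"] cong: if_cong)
  finally have eq: "Zmat B S *v (matrix_inv B *v S ! l) = d + S ! l" .
  have Ac: "(\<Sum>j<m. A $$ (i, j) * c j) = 0" if i: "i < m" for i
  proof -
    have "(A * (X * A)) $$ (i, l) = (\<Sum>j<m. A $$ (i, j) * (X * A) $$ (j, l))"
    proof -
      define Y where "Y = X * A"
      have Y: "Y \<in> carrier_mat m m" using XA by (simp add: Y_def)
      show ?thesis unfolding Y_def[symmetric]
        using A Y i lm by (simp add: scalar_prod_def atLeast0LessThan)
    qed
    then have "(\<Sum>j<m. A $$ (i, j) * (X * A) $$ (j, l)) = A $$ (i, l)"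
      by (simp add: AXA)
    then show ?thesis
      using lm by (simp add: c_def right_diff_distrib sum_subtractf if_distrib[of "\<lambda>a. _ * a"] cong: if_cong)
  qed
  have Hd: "S ! i \<bullet> (matrix_inv B *v d) = (\<Sum>j<m. A $$ (i, j) * c j)" if i: "i < m" for i
    unfolding d_def linear_sum[OF matrix_vector_mul_linear] inner_sum_right
    by (rule sum.cong) (simp_all add: matrix_vector_mult_scaleR Aij[OF i])
  have "d \<bullet> (matrix_inv B *v d) = (\<Sum>i<m. c i * (S ! i \<bullet> (matrix_inv B *v d)))"
    by (subst d_def) (simp add: inner_sum_left)
  also have "\<dots> = 0" by (rule sum.neutral) (simp add: Hd Ac)
  finally have "d = 0" by (simp add: inverse_definite)
  then show ?thesis using eq by simp
qed

text \<open>
The range of \<open>Z\<close> is spanned by columns of \<open>S\<close>, so \<open>B\<inverse> Z\<close> is idempotent.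
\<close>
lemma Zmat_inverse_Zmat: "Zmat B S *v (matrix_inv B *v (Zmat B S *v x)) = Zmat B S *v x"
proof -
  define a where "a i = (\<Sum>j<length S. pinv (sketch_gram B S) $$ (i, j) * (S ! j \<bullet> x))" for i
  have Zx: "Zmat B S *v x = (\<Sum>i<length S. a i *\<^sub>R S ! i)"
    unfolding Zmat_apply a_def ..
  show ?thesis
    unfolding Zx linear_sum[OF matrix_vector_mul_linear]
    by (rule sum.cong) (simp_all add: matrix_vector_mult_scaleR Zmat_inverse_column)
qed

text \<open>
The pseudoinverse of a symmetric matrix is symmetric, by uniqueness.
\<close>
lemma inner_Zmat: "x \<bullet> (Zmat B S *v y) = (Zmat B S *v x) \<bullet> y"
proof -
  let ?X = "pinv (sketch_gram B S)"
  have sym: "?X $$ (i, j) = ?X $$ (j, i)" if "i < length S" "j < length S" for i j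
    using arg_cong[OF transpose_pinv_symmetric[OF transpose_gram[of S]], of "\<lambda>M. M $$ (j, i)"]
      pinv_gram_carrier[of S] that by simp
  have "x \<bullet> (Zmat B S *v y) = (\<Sum>i<length S. \<Sum>j<length S. ?X $$ (i, j) * (S ! j \<bullet> y) * (S ! i \<bullet> x))"
    unfolding Zmat_apply by (simp add: inner_sum_right sum_distrib_left sum_distrib_right inner_commute mult_ac)
  also have "\<dots> = (\<Sum>i<length S. \<Sum>j<length S. ?X $$ (i, j) * (S ! j \<bullet> x) * (S ! i \<bullet> y))"
    by (subst sum.swap) (auto intro!: sum.cong simp: sym)
  also have "\<dots> = (Zmat B S *v x) \<bullet> y"
    unfolding Zmat_apply by (simp add: inner_sum_left sum_distrib_left sum_distrib_right mult_ac)
  finally show ?thesis .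
qed

end

section \<open>Measurability of the sketched projections\<close>

lemma binner_simps [simp]:
  fixes B :: "real^'n^'n"
  shows "binner B 0 y = 0" "binner B x 0 = 0"
    "binner B (x + x') y = binner B x y + binner B x' y"
    "binner B x (y + y') = binner B x y + binner B x y'"
    "binner B (x - x') y = binner B x y - binner B x' y"
    "binner B x (y - y') = binner B x y - binner B x y'"
    "binner B (c *\<^sub>R x) y = c * binner B x y"
    "binner B x (c *\<^sub>R y) = c * binner B x y"
    "binner B (- x) y = - binner B x y"
    "binner B x (- y) = - binner B x y"
  by (simp_all add: binner_def matrix_vector_mult_add_rdistrib matrix_vector_right_distrib
      matrix_vector_mult_diff_distrib matrix_vector_mult_scaleR inner_simps
      linear_neg[OF matrix_vector_mul_linear])

text \<open>
The \<open>B\<close>-orthogonal projection onto the span of the first \<open>m\<close> vectors. No normalization and no case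
distinction: when \<open>v m\<close> depends on its predecessors the residual \<open>r\<close> is zero and the correction
term vanishes through division by zero. This keeps the recursion manifestly measurable.
\<close>
primrec gram_schmidt_projection ::
    "real^'n^'n \<Rightarrow> (nat \<Rightarrow> real^'n) \<Rightarrow> nat \<Rightarrow> real^'n \<Rightarrow> real^'n" where
  "gram_schmidt_projection B v 0 x = 0"
| "gram_schmidt_projection B v (Suc m) x =
    (let r = v m - gram_schmidt_projection B v m (v m)
     in gram_schmidt_projection B v m x + (binner B r x / binner B r r) *\<^sub>R r)"

lemma gram_schmidt_projection_in_span:
  "gram_schmidt_projection B v m x \<in> span (v ` {..<m})"
proof (induction m arbitrary: x)
  case (Suc m)
  have sub: "span (v ` {..<m}) \<subseteq> span (v ` {..<Suc m})"
    by (intro span_mono) auto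
  have "v m \<in> span (v ` {..<Suc m})" by (intro span_base) auto
  then show ?case
    using Suc.IH sub by (auto simp: Let_def intro!: span_add span_scale span_diff)
qed simp

context
  fixes B :: "real^'n^'n"
  assumes B: "pos_def B"
begin

lemma binner_eq_0_iff: "binner B x x = 0 \<longleftrightarrow> x = 0"
  using B unfolding pos_def_def binner_def by force

lemma binner_commute: "binner B x y = binner B y x"
  unfolding binner_def using inner_symmetric_matrix[OF transpose_pos_def[OF B], of x y]
  by (simp add: inner_commute)

lemma binner_span_eq_0:
  assumes "y \<in> span V" "\<And>v. v \<in> V \<Longrightarrow> binner B v w = 0"
  shows "binner B y w = 0"
proof -
  have "subspace {y. binner B y w = 0}" by (auto simp: subspace_def)
  from span_minimal[OF _ this, of V] show ?thesis using assms by auto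
qed

text \<open>
The correction term removes the component along the residual \<open>r\<close>, and \<open>r\<close> is orthogonal to the
earlier vectors, so the orthogonality already achieved is kept.
\<close>
lemma gram_schmidt_projection_orthogonal:
  "i < m \<Longrightarrow> binner B (v i) (x - gram_schmidt_projection B v m x) = 0"
proof (induction m arbitrary: x i)
  case (Suc m)
  let ?P = "gram_schmidt_projection B v m"
  define r where "r = v m - ?P (v m)"
  define w where "w = x - gram_schmidt_projection B v (Suc m) x"
  have w: "w = (x - ?P x) - (binner B r x / binner B r r) *\<^sub>R r"
    by (simp add: w_def r_def Let_def)
  have old: "binner B (v i) w = 0" if "i < m" for i
    using Suc.IH[OF that, of x] Suc.IH[OF that, of "v m"] by (simp add: w r_def)
  have "binner B (?P y) r = 0" for y
    using binner_span_eq_0[OF gram_schmidt_projection_in_span, of v m r] Suc.IH[of _ "v m"]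
    by (auto simp: r_def)
  then have "binner B r (?P x) = 0" by (simp add: binner_commute)
  then have "binner B r w = 0" using binner_eq_0_iff[of r] by (cases "r = 0") (simp_all add: w)
  moreover have "binner B (?P (v m)) w = 0"
    using binner_span_eq_0[OF gram_schmidt_projection_in_span, of v m w] old by auto
  ultimately have "binner B (v m) w = 0" by (simp add: r_def)
  then show ?case using old Suc.prems unfolding w_def by (cases "i = m") auto
qed simp

lemma orthogonal_projection_unique:
  assumes "p \<in> span V" "q \<in> span V"
    and "\<And>v. v \<in> V \<Longrightarrow> binner B v (x - p) = 0" "\<And>v. v \<in> V \<Longrightarrow> binner B v (x - q) = 0"
  shows "p = q"
proof -
  have "binner B (p - q) (p - q) = 0"
  proof (rule binner_span_eq_0)
    show "p - q \<in> span V" using assms by (intro span_diff)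
    show "binner B v (p - q) = 0" if "v \<in> V" for v
      using assms(3)[OF that] assms(4)[OF that] by simp
  qed
  then have "p - q = 0" by (simp only: binner_eq_0_iff)
  then show ?thesis by simp
qed

text \<open>
Both sides, after multiplication by \<open>B\<inverse>\<close>, lie in the span of the columns of \<open>B\<inverse> S\<close> and leave a
residual orthogonal to it. Padding the sketch with zero columns makes each column a function
on all sketches, as in the definition of \<^const>\<open>sketch_space\<close>.
\<close>
lemma Zmat_eq_gram_schmidt_projection:
  "Zmat B S *v x =
    B *v gram_schmidt_projection B (\<lambda>i. matrix_inv B *v (if i < length S then S ! i else 0)) (length S) x"
proof -
  let ?v = "\<lambda>i. matrix_inv B *v (if i < length S then S ! i else 0)"
  have "matrix_inv B *v (Zmat B S *v x) = gram_schmidt_projection B ?v (length S) x"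
  proof (rule orthogonal_projection_unique)
    show "matrix_inv B *v (Zmat B S *v x) \<in> span (?v ` {..<length S})"
      unfolding Zmat_apply[OF B] linear_sum[OF matrix_vector_mul_linear] matrix_vector_mult_scaleR
      by (intro span_sum span_scale span_base) auto
    show "binner B w (x - matrix_inv B *v (Zmat B S *v x)) = 0" if "w \<in> ?v ` {..<length S}" for w
    proof -
      obtain i where i: "i < length S" and w: "w = matrix_inv B *v S ! i" using \<open>w \<in> _\<close> by auto
      have "binner B w y = S ! i \<bullet> y" for y
        using B by (simp add: binner_def w inner_inverse[symmetric])
      moreover have "S ! i \<bullet> (matrix_inv B *v (Zmat B S *v x)) = S ! i \<bullet> x"
        using i by (simp add: inner_inverse[OF B] inner_Zmat[OF B] Zmat_inverse_column[OF B])
      ultimately show ?thesis by (simp add: inner_simps)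
    qed
    show "gram_schmidt_projection B ?v (length S) x \<in> span (?v ` {..<length S})"
      by (rule gram_schmidt_projection_in_span)
    show "binner B w (x - gram_schmidt_projection B ?v (length S) x) = 0"
      if "w \<in> ?v ` {..<length S}" for w
      using that gram_schmidt_projection_orthogonal[of _ "length S" ?v] by auto
  qed
  from arg_cong[OF this, of "(*v) B"] show ?thesis using B by simp
qed

end

lemma measurable_matrix_vector_mult [measurable (raw)]:
  fixes A :: "real^'n^'m"
  assumes "f \<in> borel_measurable N"
  shows "(\<lambda>s. A *v f s) \<in> borel_measurable N"
  by (rule measurable_compose[OF assms
      borel_measurable_continuous_onI[OF linear_continuous_on[OF matrix_vector_mul_bounded_linear]]])

lemma measurable_binner [measurable (raw)]:
  assumes "f \<in> borel_measurable N" "g \<in> borel_measurable N"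
  shows "(\<lambda>s. binner B (f s) (g s)) \<in> borel_measurable N"
  unfolding binner_def using assms by measurable

lemma measurable_gram_schmidt_projection:
  assumes v [measurable]: "\<And>i. (\<lambda>s. v s i) \<in> borel_measurable N"
    and x [measurable]: "x \<in> borel_measurable N"
  shows "(\<lambda>s. gram_schmidt_projection B (v s) m (x s)) \<in> borel_measurable N"
  using x
proof (induction m arbitrary: x)
  case (Suc m)
  note Suc.prems [measurable]
  have [measurable]: "(\<lambda>s. gram_schmidt_projection B (v s) m (x s)) \<in> borel_measurable N"
    "(\<lambda>s. gram_schmidt_projection B (v s) m (v s m)) \<in> borel_measurable N"
    by (intro Suc.IH Suc.prems v)+
  show ?case unfolding gram_schmidt_projection.simps Let_def by measurable
qed simp

lemma measurable_sketch_raw: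
  "(\<lambda>S. (length S, \<lambda>j. if j < length S then S ! j else 0)) \<in>
    (sketch_space :: ('n::finite) sketch measure) \<rightarrow>\<^sub>M
      (count_space UNIV \<Otimes>\<^sub>M (\<Pi>\<^sub>M j\<in>(UNIV :: nat set). (borel :: (real^'n) measure)))"
  unfolding sketch_space_def
  by (rule measurable_vimage_algebra1) (simp add: space_pair_measure space_PiM PiE_def)

lemma measurable_sketch_length: "length \<in> (sketch_space :: ('n::finite) sketch measure) \<rightarrow>\<^sub>M count_space UNIV"
  using measurable_compose[OF measurable_sketch_raw measurable_fst] by simp

lemma measurable_sketch_column:
  "(\<lambda>S. if j < length S then S ! j else 0) \<in> borel_measurable (sketch_space :: ('n::finite) sketch measure)"
  using measurable_compose[OF measurable_compose[OF measurable_sketch_raw measurable_snd]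
      measurable_component_singleton[of j UNIV]] by simp

text \<open>
For a fixed number of columns the Gram-Schmidt recursion is measurable in the columns, and the number
of columns is a measurable function with countably many values.
\<close>
lemma measurable_Zmat_apply:
  fixes B :: "real^'n^'n"
  assumes "pos_def B"
  shows "(\<lambda>S. Zmat B S *v x) \<in> borel_measurable sketch_space"
proof -
  have "(\<lambda>S. gram_schmidt_projection B (\<lambda>i. matrix_inv B *v (if i < length S then S ! i else 0)) m x)
      \<in> borel_measurable sketch_space" for m
    by (rule measurable_gram_schmidt_projection)
      (rule measurable_matrix_vector_mult[OF measurable_sketch_column] measurable_const, simp)+
  from measurable_matrix_vector_mult[OF measurable_compose_countable[OF this measurable_sketch_length]]
  show ?thesis unfolding Zmat_eq_gram_schmidt_projection[OF assms] .
qed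

lemma measurable_Zmat:
  fixes B :: "real^'n^'n"
  assumes "pos_def B"
  shows "Zmat B \<in> borel_measurable sketch_space"
proof (subst borel_measurable_euclidean_space, rule ballI)
  fix b :: "real^'n^'n" assume "b \<in> Basis"
  then obtain i j where b: "b = axis i (axis j 1)" by (auto simp: Basis_vec_def)
  have "Zmat B S \<bullet> b = axis i 1 \<bullet> (Zmat B S *v axis j 1)" for S
    by (simp add: b inner_axis inner_axis' matrix_vector_mul_component)
  then show "(\<lambda>S. Zmat B S \<bullet> b) \<in> borel_measurable sketch_space"
    using measurable_Zmat_apply[OF assms, of "axis j 1"] by simp
qed

lemma measurable_Zmat_mult:
  fixes B :: "real^'n^'n"
  assumes "pos_def B" and "S \<in> N \<rightarrow>\<^sub>M sketch_space" and y: "y \<in> borel_measurable N"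
  shows "(\<lambda>s. Zmat B (S s) *v y s) \<in> borel_measurable N"
proof -
  have Z [measurable]: "(\<lambda>s. Zmat B (S s)) \<in> borel_measurable N"
    using measurable_compose[OF assms(2) measurable_Zmat[OF assms(1)]] .
  have "continuous_on UNIV (\<lambda>(A :: real^'n^'n, y). A *v y)"
    unfolding matrix_vector_mult_def case_prod_beta by (intro continuous_intros)
  from borel_measurable_continuous_Pair[OF Z y this[unfolded case_prod_beta', simplified]]
  show ?thesis by (simp add: case_prod_beta)
qed

section \<open>Subgradients and the proximal operator\<close>

text \<open>
The Riesz representation of the derivative with respect to the inner product of \<open>B\<close>.
\<close>
lemma Bgrad_derivative:
  fixes f :: "real^'n \<Rightarrow> real"
  assumes B: "pos_def B" and f: "f differentiable (at x)"
  shows "(f has_derivative binner B (Bgrad B f x)) (at x)"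
proof -
  obtain f' where f': "(f has_derivative f') (at x)"
    using f unfolding differentiable_def by blast
  define g where "g = matrix_inv B *v (\<Sum>b\<in>Basis. f' b *\<^sub>R b)"
  have "binner B g = f'"
  proof
    fix d
    have "binner B g d = (\<Sum>b\<in>Basis. f' b *\<^sub>R b) \<bullet> d"
      using B by (simp add: g_def binner_def inner_inverse[symmetric])
    also have "\<dots> = (\<Sum>b\<in>Basis. (d \<bullet> b) * f' b)"
      by (simp add: inner_sum_left inner_commute[of d] mult.commute)
    also have "\<dots> = f' (\<Sum>b\<in>Basis. (d \<bullet> b) *\<^sub>R b)"
      using has_derivative_linear[OF f'] by (simp add: linear_sum linear_cmul)
    finally show "binner B g d = f' d" by (simp add: euclidean_representation)
  qed
  then have g: "(f has_derivative binner B g) (at x)" using f' by simp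
  have "g' = g" if "(f has_derivative binner B g') (at x)" for g'
  proof -
    have "binner B g' = binner B g" by (rule has_derivative_unique[OF that g])
    then have "binner B (g' - g) (g' - g) = 0" by simp
    then have "g' - g = 0" by (simp only: binner_eq_0_iff[OF B])
    then show ?thesis by simp
  qed
  then show ?thesis
    using theI[of "\<lambda>g. (f has_derivative binner B g) (at x)", OF g] unfolding Bgrad_def by blast
qed

lemma normsq_binner: "normsq B x = binner B x x"
  by (simp add: normsq_def binner_def)

lemma normsq_nonneg: "pos_def B \<Longrightarrow> 0 \<le> normsq B x"
  by (cases "x = 0") (simp_all add: normsq_def pos_def_def less_imp_le)

lemma normsq_add_scaleR:
  assumes "pos_def B"
  shows "normsq B (x + a *\<^sub>R y) = normsq B x + 2 * a * binner B x y + a\<^sup>2 * normsq B y"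
  using binner_commute[OF assms, of y x] by (simp add: normsq_binner power2_eq_square algebra_simps)

text \<open>
Subgradients are taken with respect to the inner product of \<open>B\<close>. Finiteness at \<open>p\<close> is part of the
notion, so that the two inequalities at two points can be added.
\<close>
definition is_subgradient :: "real^'n^'n \<Rightarrow> (real^'n \<Rightarrow> ereal) \<Rightarrow> real^'n \<Rightarrow> real^'n \<Rightarrow> bool" where
  "is_subgradient B R p u \<longleftrightarrow> \<bar>R p\<bar> \<noteq> \<infinity> \<and> (\<forall>y. R p + ereal (binner B u (y - p)) \<le> R y)"

text \<open>
First-order optimality for a smooth plus a convex function. Along the segment from \<open>p\<close> to \<open>y\<close>,
convexity bounds \<open>R\<close> by its chord, so \<open>g\<close> plus the chord is minimal at the start of the segment and
has a nonnegative derivative there.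
\<close>
lemma minimizer_subgradient:
  assumes R: "convex_fun R" and range: "\<forall>x. R x \<noteq> -\<infinity>" and fin: "R p \<noteq> \<infinity>"
    and der: "(g has_derivative binner B w) (at p)"
    and min: "\<And>y. ereal (g p) + R p \<le> ereal (g y) + R y"
  shows "is_subgradient B R p (- w)"
proof -
  obtain a where a: "R p = ereal a" using fin range by (cases "R p") auto
  have "R p + ereal (binner B (- w) (y - p)) \<le> R y" for y
  proof (cases "R y")
    case (real b)
    define \<phi> where "\<phi> t = g (p + t *\<^sub>R (y - p)) + t * (b - a)" for t
    have "((\<lambda>t. p + t *\<^sub>R (y - p)) has_derivative (\<lambda>t. t *\<^sub>R (y - p))) (at 0)"
      by (auto intro!: derivative_eq_intros)
    moreover have "(g has_derivative binner B w) (at (p + 0 *\<^sub>R (y - p)))" using der by simp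
    ultimately have "((\<lambda>t. g (p + t *\<^sub>R (y - p))) has_derivative (\<lambda>t. binner B w (t *\<^sub>R (y - p)))) (at 0)"
      by (rule has_derivative_compose)
    then have "((\<lambda>t. g (p + t *\<^sub>R (y - p))) has_real_derivative binner B w (y - p)) (at 0)"
      by (rule has_derivative_imp_has_field_derivative) simp
    then have \<phi>': "(\<phi> has_real_derivative binner B w (y - p) + (b - a)) (at 0)"
      unfolding \<phi>_def by (auto intro!: derivative_eq_intros)
    have ge: "\<phi> 0 \<le> \<phi> t" if t: "0 < t" "t < 1" for t
    proof -
      have "(p, a) \<in> ereal_epigraph R" "(y, b) \<in> ereal_epigraph R"
        using a real by (simp_all add: ereal_epigraph_def)
      then have "(1 - t) *\<^sub>R (p, a) + t *\<^sub>R (y, b) \<in> ereal_epigraph R"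
        using R t unfolding convex_fun_def by (intro convexD) auto
      then have "R ((1 - t) *\<^sub>R p + t *\<^sub>R y) \<le> ereal ((1 - t) * a + t * b)"
        by (simp add: ereal_epigraph_def)
      moreover have "(1 - t) *\<^sub>R p + t *\<^sub>R y = p + t *\<^sub>R (y - p)" by (simp add: algebra_simps)
      ultimately have "R (p + t *\<^sub>R (y - p)) \<le> ereal ((1 - t) * a + t * b)" by simp
      then have "ereal (g p) + R p \<le> ereal (g (p + t *\<^sub>R (y - p))) + ereal ((1 - t) * a + t * b)"
        using min[of "p + t *\<^sub>R (y - p)"] by (meson add_left_mono order_trans)
      then show ?thesis by (simp add: a \<phi>_def algebra_simps)
    qed
    have "0 \<le> binner B w (y - p) + (b - a)"
    proof (rule ccontr)
      assume "\<not> ?thesis"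
      then obtain e where "e > 0" and e: "\<And>h. 0 < h \<Longrightarrow> h < e \<Longrightarrow> \<phi> (0 + h) < \<phi> 0"
        using has_real_derivative_neg_dec_right[OF \<phi>'] by auto
      define h where "h = min (e / 2) (1 / 2)"
      have "0 < h" "h < e" "h < 1" using \<open>e > 0\<close> by (auto simp: h_def)
      then show False using e[of h] ge[of h] by simp
    qed
    then show ?thesis using a real by simp
  qed (use range in auto)
  then show ?thesis using a by (simp add: is_subgradient_def)
qed

text \<open>
Monotonicity of the subdifferential: the resolvent of a monotone operator is nonexpansive.
\<close>
lemma subgradient_nonexpansive:
  assumes B: "pos_def B" and u: "is_subgradient B R p u" and v: "is_subgradient B R q v"
    and \<alpha>: "0 \<le> \<alpha>"
  shows "normsq B (p - q) \<le> normsq B ((p + \<alpha> *\<^sub>R u) - (q + \<alpha> *\<^sub>R v))"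
proof -
  obtain a b where a: "R p = ereal a" and b: "R q = ereal b"
    using u v unfolding is_subgradient_def by (cases "R p"; cases "R q") auto
  have "a + binner B u (q - p) \<le> b" "b + binner B v (p - q) \<le> a"
    using u[unfolded is_subgradient_def, THEN conjunct2, rule_format, of q]
      v[unfolded is_subgradient_def, THEN conjunct2, rule_format, of p]
    by (simp_all add: a b)
  then have "0 \<le> binner B (p - q) (u - v)"
    using binner_commute[OF B, of u "q - p"] binner_commute[OF B, of v "p - q"] by simp
  then have "0 \<le> 2 * \<alpha> * binner B (p - q) (u - v)" using \<alpha> by simp
  moreover have "0 \<le> \<alpha>\<^sup>2 * normsq B (u - v)" using normsq_nonneg[OF B] by simp
  moreover have eq: "(p + \<alpha> *\<^sub>R u) - (q + \<alpha> *\<^sub>R v) = (p - q) + \<alpha> *\<^sub>R (u - v)"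
    by (simp add: algebra_simps)
  ultimately show ?thesis unfolding eq normsq_add_scaleR[OF B] by linarith
qed

text \<open>
The quadratic form attains a positive minimum on the unit sphere; then scale.
\<close>
lemma pos_def_lower_bound:
  fixes A :: "real^'n^'n"
  assumes A: "pos_def A"
  obtains c where "c > 0" "\<And>x. c * (norm x)\<^sup>2 \<le> normsq A x"
proof -
  have cont: "continuous_on (sphere 0 1) (normsq A)"
    unfolding normsq_def[abs_def] by (intro continuous_intros linear_continuous_on matrix_vector_mul_bounded_linear)
  have "sphere (0 :: real^'n) 1 \<noteq> {}" by (metis norm_axis_1 mem_sphere_0 empty_iff)
  then obtain u where u: "u \<in> sphere 0 1" and le: "\<And>y. y \<in> sphere 0 1 \<Longrightarrow> normsq A u \<le> normsq A y"
    using continuous_attains_inf[OF compact_sphere _ cont] by blast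
  have "u \<noteq> 0" using u by auto
  then have pos: "normsq A u > 0" using A by (simp add: pos_def_def normsq_def)
  have "normsq A u * (norm x)\<^sup>2 \<le> normsq A x" for x
  proof (cases "x = 0")
    case False
    have "normsq A u \<le> normsq A ((1 / norm x) *\<^sub>R x)" using False by (intro le) simp
    also have "\<dots> = normsq A x / (norm x)\<^sup>2"
      by (simp add: normsq_binner power2_eq_square)
    finally show ?thesis using False by (simp add: pos_le_divide_eq)
  qed (simp add: normsq_def)
  then show thesis using that pos by blast
qed

lemma normsq_upper_bound:
  fixes A :: "real^'n^'n"
  shows "normsq A x \<le> onorm ((*v) A) * (norm x)\<^sup>2"
proof -
  have "normsq A x \<le> norm x * norm (A *v x)"
    unfolding normsq_def by (rule norm_cauchy_schwarz)
  also have "\<dots> \<le> norm x * (onorm ((*v) A) * norm x)"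
    by (intro mult_left_mono onorm matrix_vector_mul_bounded_linear) auto
  finally show ?thesis by (simp add: power2_eq_square mult_ac)
qed

text \<open>
The subgradient provides an affine minorant of \<open>R\<close>, and an affine function plus a positive definite
quadratic has bounded sublevel sets. The minimum is sought over a sublevel set of the
epigraph, which is compact, instead of over points, because \<open>R\<close> takes infinite values.
\<close>
lemma prox_objective_attains_min:
  fixes R :: "real^'n \<Rightarrow> ereal"
  assumes B: "pos_def B" and R: "closed_fun R" and range: "\<forall>x. R x \<noteq> -\<infinity>"
    and q: "is_subgradient B R q w" and \<alpha>: "\<alpha> > 0"
  shows "\<exists>p. \<forall>y. R p + ereal (1 / (2 * \<alpha>) * normsq B (p - x)) \<le> R y + ereal (1 / (2 * \<alpha>) * normsq B (y - x))"
proof -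
  define h where "h y = 1 / (2 * \<alpha>) * normsq B (y - x)" for y
  have h_cont: "continuous_on UNIV h"
  proof -
    have "continuous_on UNIV (\<lambda>y. B *v (y - x))"
      by (rule continuous_on_compose2[OF linear_continuous_on[OF matrix_vector_mul_bounded_linear]])
        (auto intro!: continuous_intros)
    then show ?thesis unfolding h_def normsq_def by (intro continuous_intros)
  qed
  have h_nonneg: "0 \<le> h y" for y
    using normsq_nonneg[OF B] \<alpha> by (simp add: h_def)
  obtain r where r: "R q = ereal r" using q unfolding is_subgradient_def by (cases "R q") auto
  have minorant: "r + binner B w (y - q) \<le> t" if "R y \<le> ereal t" for y t
    using order_trans[OF q[unfolded is_subgradient_def, THEN conjunct2, rule_format, of y] that]
    by (simp add: r)
  define K where "K = ereal_epigraph R \<inter> {z. snd z + h (fst z) \<le> r + h q}"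
  have obj_cont: "continuous_on UNIV (\<lambda>z :: (real^'n) \<times> real. snd z + h (fst z))"
    by (intro continuous_intros continuous_on_compose2[OF h_cont]) auto
  have "closed K"
    unfolding K_def using R obj_cont
    by (intro closed_Int closed_Collect_le) (auto simp: closed_fun_def)
  moreover have "bounded K"
  proof -
    obtain c where c: "c > 0" "\<And>y. c * (norm y)\<^sup>2 \<le> normsq B y" using pos_def_lower_bound[OF B] by metis
    define C where "C = h q + \<alpha> / 2 * normsq B w - binner B w (x - q)"
    define s where "s = sqrt (2 * \<alpha> * C / c) + norm (x - \<alpha> *\<^sub>R w)"
    have "y \<in> cball 0 s \<and> t \<in> {r - norm (B *v w) * (s + norm q)..r + h q}" if "(y, t) \<in> K" for y t
    proof -
      have le: "R y \<le> ereal t" "t + h y \<le> r + h q" using that by (auto simp: K_def ereal_epigraph_def)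
      have sq: "normsq B (y - (x - \<alpha> *\<^sub>R w)) / (2 * \<alpha>) = h y + binner B w (y - x) + \<alpha> / 2 * normsq B w"
      proof -
        have "y - (x - \<alpha> *\<^sub>R w) = (y - x) + \<alpha> *\<^sub>R w" by simp
        then show ?thesis
          using \<alpha> binner_commute[OF B, of "y - x" w]
          by (simp only: normsq_add_scaleR[OF B] h_def) (simp add: field_simps power2_eq_square)
      qed
      have "r + binner B w (y - q) + h y \<le> r + h q" using minorant[OF le(1)] le(2) by simp
      then have "normsq B (y - (x - \<alpha> *\<^sub>R w)) / (2 * \<alpha>) \<le> C"
        unfolding sq C_def by simp
      then have "normsq B (y - (x - \<alpha> *\<^sub>R w)) \<le> 2 * \<alpha> * C" using \<alpha> by (simp add: field_simps)
      then have "(norm (y - (x - \<alpha> *\<^sub>R w)))\<^sup>2 \<le> 2 * \<alpha> * C / c"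
        using c(1) c(2)[of "y - (x - \<alpha> *\<^sub>R w)"] by (simp add: field_simps)
      then have "norm (y - (x - \<alpha> *\<^sub>R w)) \<le> sqrt (2 * \<alpha> * C / c)" by (rule real_le_rsqrt)
      then have ys: "norm y \<le> s" unfolding s_def using norm_triangle_sub[of y "x - \<alpha> *\<^sub>R w"] by linarith
      have "\<bar>binner B w (y - q)\<bar> = \<bar>(B *v w) \<bullet> (y - q)\<bar>"
        unfolding binner_def using inner_symmetric_matrix[OF transpose_pos_def[OF B], of w "y - q"] by simp
      also have "\<dots> \<le> norm (B *v w) * norm (y - q)" by (rule Cauchy_Schwarz_ineq2)
      also have "\<dots> \<le> norm (B *v w) * (s + norm q)"
        using ys norm_triangle_ineq4[of y q] by (intro mult_left_mono) auto
      finally have "r - norm (B *v w) * (s + norm q) \<le> t" using minorant[OF le(1)] by linarith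
      moreover have "t \<le> r + h q" using le(2) h_nonneg[of y] by linarith
      ultimately show ?thesis using ys by simp
    qed
    then have "K \<subseteq> cball 0 s \<times> {r - norm (B *v w) * (s + norm q)..r + h q}" by auto
    then show ?thesis using bounded_subset bounded_Times bounded_cball bounded_closed_interval by metis
  qed
  ultimately have "compact K" by (simp add: compact_eq_bounded_closed)
  moreover have "(q, r) \<in> K" by (simp add: K_def ereal_epigraph_def r)
  ultimately obtain z where z: "z \<in> K" and z_min: "\<And>z'. z' \<in> K \<Longrightarrow> snd z + h (fst z) \<le> snd z' + h (fst z')"
    using continuous_attains_inf[of K, OF _ _ continuous_on_subset[OF obj_cont]] by blast
  obtain p t where pt: "z = (p, t)" by (cases z)
  have "R p + ereal (h p) \<le> R y + ereal (h y)" for y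
  proof (cases "R y")
    case (real s)
    have "t + h p \<le> s + h y"
    proof (cases "s + h y \<le> r + h q")
      case True
      then have "(y, s) \<in> K" using real by (simp add: K_def ereal_epigraph_def)
      from z_min[OF this] show ?thesis by (simp add: pt)
    next
      case False
      then show ?thesis using z by (simp add: pt K_def)
    qed
    moreover have "R p \<le> ereal t" using z by (simp add: pt K_def ereal_epigraph_def)
    ultimately have "R p + ereal (h p) \<le> ereal (s + h y)"
      by (metis add_right_mono ereal_less_eq(3) order_trans plus_ereal.simps(1))
    then show ?thesis using real by simp
  qed (use range in auto)
  then show ?thesis unfolding h_def by blast
qed

text \<open>
The proximal point is characterized by first-order optimality, the gradient of the quadratic term
being \<open>(p - x) / \<alpha>\<close>.
\<close>
lemma prox_subgradient:
  fixes R :: "real^'n \<Rightarrow> ereal"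
  assumes B: "pos_def B" and R: "closed_fun R" "convex_fun R" and range: "\<forall>x. R x \<noteq> -\<infinity>"
    and q: "is_subgradient B R q w" and \<alpha>: "\<alpha> > 0"
  shows "is_subgradient B R (prox B \<alpha> R x) ((1 / \<alpha>) *\<^sub>R (x - prox B \<alpha> R x))"
proof -
  define p where "p = prox B \<alpha> R x"
  let ?h = "\<lambda>y. 1 / (2 * \<alpha>) * normsq B (y - x)"
  have "\<exists>p. is_arg_min (\<lambda>y. R y + ereal (?h y)) (\<lambda>_. True) p"
    using prox_objective_attains_min[OF B R(1) range q \<alpha>, of x] by (auto simp: is_arg_min_def not_less)
  then have "is_arg_min (\<lambda>y. R y + ereal (?h y)) (\<lambda>_. True) p"
    unfolding p_def prox_def arg_min_def by (rule someI_ex)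
  then have min: "R p + ereal (?h p) \<le> R y + ereal (?h y)" for y
    by (auto simp: is_arg_min_def not_less)
  have "R q \<noteq> \<infinity>" using q by (auto simp: is_subgradient_def)
  then have fin: "R p \<noteq> \<infinity>" using min[of q] by (cases "R q") auto
  have "((\<lambda>y. B *v (y - x)) has_derivative (*v) B) (at p)"
    by (auto intro!: derivative_eq_intros bounded_linear.has_derivative[OF matrix_vector_mul_bounded_linear])
  then have "((\<lambda>y. normsq B (y - x)) has_derivative (\<lambda>d. (p - x) \<bullet> (B *v d) + d \<bullet> (B *v (p - x)))) (at p)"
    unfolding normsq_def by (auto intro!: derivative_eq_intros)
  from has_derivative_mult_right[OF this, of "1 / (2 * \<alpha>)"]
  have "(?h has_derivative (\<lambda>d. 1 / (2 * \<alpha>) * ((p - x) \<bullet> (B *v d) + d \<bullet> (B *v (p - x))))) (at p)" .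
  moreover have "(\<lambda>d. 1 / (2 * \<alpha>) * ((p - x) \<bullet> (B *v d) + d \<bullet> (B *v (p - x))))
      = binner B ((1 / \<alpha>) *\<^sub>R (p - x))"
    unfolding binner_def[symmetric] binner_commute[OF B, of _ "p - x"]
    using \<alpha> by (intro ext) (simp add: field_simps)
  ultimately have "(?h has_derivative binner B ((1 / \<alpha>) *\<^sub>R (p - x))) (at p)" by (simp only:)
  from minimizer_subgradient[OF R(2) range fin this] min
  have "is_subgradient B R p (- ((1 / \<alpha>) *\<^sub>R (p - x)))" by (simp add: add.commute)
  moreover have "- ((1 / \<alpha>) *\<^sub>R (p - x)) = (1 / \<alpha>) *\<^sub>R (x - p)" by (simp add: algebra_simps)
  ultimately show ?thesis unfolding p_def by simp
qed

text \<open>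
If \<open>w\<close> is a subgradient at \<open>q\<close>, then \<open>q\<close> is the proximal point of \<open>q + \<alpha> w\<close>. The estimate serves
twice: with a second proximal point as \<open>q\<close> it gives continuity, and with the minimizer of \<open>F\<close> as
\<open>q\<close> it gives the descent of the iterates.
\<close>
lemma prox_nonexpansive_subgradient:
  fixes R :: "real^'n \<Rightarrow> ereal"
  assumes B: "pos_def B" and R: "closed_fun R" "convex_fun R" and range: "\<forall>x. R x \<noteq> -\<infinity>"
    and q: "is_subgradient B R q w" and \<alpha>: "\<alpha> > 0"
  shows "normsq B (prox B \<alpha> R x - q) \<le> normsq B (x - (q + \<alpha> *\<^sub>R w))"
  using subgradient_nonexpansive[OF B prox_subgradient[OF assms, of x] q, of \<alpha>] \<alpha> by simp

lemma continuous_prox: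
  fixes R :: "real^'n \<Rightarrow> ereal"
  assumes B: "pos_def B" and R: "closed_fun R" "convex_fun R" and range: "\<forall>x. R x \<noteq> -\<infinity>"
    and q: "is_subgradient B R q w" and \<alpha>: "\<alpha> > 0"
  shows "continuous_on UNIV (prox B \<alpha> R)"
proof -
  obtain c where c: "c > 0" "\<And>y. c * (norm y)\<^sup>2 \<le> normsq B y" using pos_def_lower_bound[OF B] by metis
  define L where "L = sqrt (onorm ((*v) B) / c)"
  have L: "0 \<le> L" using c onorm_pos_le[OF matrix_vector_mul_bounded_linear[of B]] by (simp add: L_def)
  have "L-lipschitz_on UNIV (prox B \<alpha> R)"
  proof (rule lipschitz_onI[OF _ L])
    fix x y
    have "c * (norm (prox B \<alpha> R x - prox B \<alpha> R y))\<^sup>2 \<le> onorm ((*v) B) * (norm (x - y))\<^sup>2"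
      using c(2)[of "prox B \<alpha> R x - prox B \<alpha> R y"] normsq_upper_bound[of B "x - y"]
        prox_nonexpansive_subgradient[OF B R range prox_subgradient[OF assms, of y] \<alpha>, of x] \<alpha> by simp
    then have "(norm (prox B \<alpha> R x - prox B \<alpha> R y))\<^sup>2 \<le> onorm ((*v) B) / c * (norm (x - y))\<^sup>2"
      using c(1) by (simp add: pos_le_divide_eq mult.commute)
    then have "norm (prox B \<alpha> R x - prox B \<alpha> R y) \<le> sqrt (onorm ((*v) B) / c * (norm (x - y))\<^sup>2)"
      by (rule real_le_rsqrt)
    then show "dist (prox B \<alpha> R x) (prox B \<alpha> R y) \<le> L * dist x y"
      by (simp only: L_def dist_norm real_sqrt_mult real_sqrt_abs abs_norm_cancel)
  qed
  then show ?thesis by (rule lipschitz_on_continuous_on)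
qed

section \<open>The gradient of a smooth, strongly convex function\<close>

text \<open>
Smoothness for \<open>(x, y)\<close> and for \<open>(y, x)\<close> add up to cocoercivity of the gradient, which with the
Cauchy-Schwarz inequality yields a Lipschitz bound.
\<close>
lemma continuous_Bgrad:
  fixes f :: "real^'n \<Rightarrow> real"
  assumes Q: "pos_def Q" and f: "Q_smooth B Q f"
  shows "continuous_on UNIV (Bgrad B f)"
proof -
  obtain c where c: "c > 0" "\<And>y. c * (norm y)\<^sup>2 \<le> normsq Q y" using pos_def_lower_bound[OF Q] by metis
  define L where "L = onorm ((*v) B) / c"
  have L: "0 \<le> L" using c onorm_pos_le[OF matrix_vector_mul_bounded_linear[of B]] by (simp add: L_def)
  have "L-lipschitz_on UNIV (Bgrad B f)"
  proof (rule lipschitz_onI[OF _ L])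
    fix x y
    let ?d = "Bgrad B f x - Bgrad B f y"
    have neg: "normsq Q (Bgrad B f y - Bgrad B f x) = normsq Q ?d"
      unfolding normsq_binner by simp
    have "1 / 2 * normsq Q ?d \<le> f x - f y - binner B (Bgrad B f y) (x - y)"
      "1 / 2 * normsq Q ?d \<le> f y - f x - binner B (Bgrad B f x) (y - x)"
      using f[unfolded Q_smooth_def, rule_format, of y x] f[unfolded Q_smooth_def, rule_format, of x y]
      by (simp_all add: neg)
    then have "normsq Q ?d \<le> binner B ?d (x - y)" by simp
    also have "\<dots> \<le> norm ?d * norm (B *v (x - y))"
      unfolding binner_def by (rule norm_cauchy_schwarz)
    also have "\<dots> \<le> norm ?d * (onorm ((*v) B) * norm (x - y))"
      by (intro mult_left_mono onorm matrix_vector_mul_bounded_linear) auto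
    finally have "c * (norm ?d)\<^sup>2 \<le> norm ?d * (onorm ((*v) B) * norm (x - y))"
      using c(2)[of ?d] by simp
    then have "c * norm ?d \<le> onorm ((*v) B) * norm (x - y)" if "?d \<noteq> 0"
      using that by (simp add: power2_eq_square mult.left_commute)
    then have "norm ?d \<le> L * norm (x - y)"
      using c(1) L by (cases "?d = 0") (simp_all add: L_def pos_le_divide_eq mult.commute)
    then show "dist (Bgrad B f x) (Bgrad B f y) \<le> L * dist x y" by (simp add: dist_norm)
  qed
  then show ?thesis by (rule lipschitz_on_continuous_on)
qed

text \<open>
The sum of the smoothness inequality for \<open>(x, y)\<close> and the strong convexity inequality for
\<open>(y, x)\<close>; the function values cancel.
\<close>
lemma smooth_strongly_convex_monotone:
  fixes f :: "real^'n \<Rightarrow> real"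
  assumes smooth: "Q_smooth B Q f" and convex: "strongly_convex B \<mu> f"
  shows "\<mu> / 2 * normsq B (x - y) + 1 / 2 * normsq Q (Bgrad B f x - Bgrad B f y)
    \<le> binner B (Bgrad B f x - Bgrad B f y) (x - y)"
proof -
  have "f y + binner B (Bgrad B f y) (x - y) + 1 / 2 * normsq Q (Bgrad B f x - Bgrad B f y) \<le> f x"
    using smooth[unfolded Q_smooth_def, rule_format, of x y] by simp
  moreover have "f x + binner B (Bgrad B f x) (y - x) + \<mu> / 2 * normsq B (y - x) \<le> f y"
    using convex unfolding strongly_convex_def by blast
  moreover have "normsq B (y - x) = normsq B (x - y)" unfolding normsq_binner by simp
  ultimately show ?thesis by simp
qed

section \<open>One step of SEGA in expectation\<close>

lemma integral_matrix_form:
  fixes A :: "'s \<Rightarrow> real^'n^'n"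
  assumes "integrable N A"
  shows "integrable N (\<lambda>s. x \<bullet> (A s *v y))"
    and "(\<integral>s. x \<bullet> (A s *v y) \<partial>N) = x \<bullet> ((\<integral>s. A s \<partial>N) *v y)"
proof -
  have "linear (\<lambda>M :: real^'n^'n. x \<bullet> (M *v y))"
    by (rule linearI)
      (simp_all add: matrix_vector_mult_add_rdistrib inner_add_right scaleR_matrix_vector_assoc[symmetric])
  then have bl: "bounded_linear (\<lambda>M :: real^'n^'n. x \<bullet> (M *v y))"
    by (simp add: linear_conv_bounded_linear)
  show "integrable N (\<lambda>s. x \<bullet> (A s *v y))" by (rule integrable_bounded_linear[OF bl assms])
  show "(\<integral>s. x \<bullet> (A s *v y) \<partial>N) = x \<bullet> ((\<integral>s. A s \<partial>N) *v y)"
    by (rule integral_bounded_linear[OF bl assms])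
qed

context
  fixes B :: "real^'n^'n"
  assumes B: "pos_def B"
begin

lemma binner_projection: "binner B x (matrix_inv B *v (Zmat B S *v y)) = x \<bullet> (Zmat B S *v y)"
  using B by (simp add: binner_def)

lemma normsq_projection: "normsq B (matrix_inv B *v (Zmat B S *v x)) = x \<bullet> (Zmat B S *v x)"
  unfolding normsq_binner binner_projection inner_Zmat[OF B]
  using B by (simp add: Zmat_inverse_Zmat inner_commute)

text \<open>
The form of \<open>Z\<close> is the squared \<open>B\<close>-norm of a \<open>B\<close>-orthogonal projection.
\<close>
lemma Zmat_form_bounds: "0 \<le> x \<bullet> (Zmat B S *v x)" "x \<bullet> (Zmat B S *v x) \<le> normsq B x"
proof -
  show "0 \<le> x \<bullet> (Zmat B S *v x)"
    unfolding normsq_projection[symmetric] by (rule normsq_nonneg[OF B])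
  have "0 \<le> normsq B (x + (-1) *\<^sub>R (matrix_inv B *v (Zmat B S *v x)))"
    by (rule normsq_nonneg[OF B])
  then show "x \<bullet> (Zmat B S *v x) \<le> normsq B x"
    unfolding normsq_add_scaleR[OF B] normsq_projection binner_projection by simp
qed

text \<open>
Polarization reduces the bilinear form to the quadratic one at \<open>x + y\<close> and \<open>x - y\<close>.
\<close>
lemma Zmat_form_bounded:
  assumes "norm x = 1" "norm y = 1"
  shows "\<bar>x \<bullet> (Zmat B S *v y)\<bar> \<le> onorm ((*v) B)"
proof -
  let ?q = "\<lambda>x. x \<bullet> (Zmat B S *v x)" and ?K = "onorm ((*v) B)"
  have K: "0 \<le> ?K" by (rule onorm_pos_le[OF matrix_vector_mul_bounded_linear])
  have q: "?q z \<le> 4 * ?K" if "norm z \<le> 2" for z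
  proof -
    have "?q z \<le> ?K * (norm z)\<^sup>2"
      using Zmat_form_bounds(2)[of z S] normsq_upper_bound[of B z] by simp
    also have "\<dots> \<le> ?K * 2\<^sup>2" using that K by (intro mult_left_mono power_mono) auto
    finally show ?thesis by simp
  qed
  have "norm (x + y) \<le> 2" "norm (x - y) \<le> 2"
    using norm_triangle_ineq[of x y] norm_triangle_ineq4[of x y] assms by auto
  moreover have "4 * (x \<bullet> (Zmat B S *v y)) = ?q (x + y) - ?q (x - y)"
    using inner_Zmat[OF B, of x S y]
    by (simp add: matrix_vector_right_distrib matrix_vector_mult_diff_distrib inner_simps inner_commute)
  ultimately show ?thesis
    using q[of "x + y"] q[of "x - y"] Zmat_form_bounds(1)[of "x + y" S] Zmat_form_bounds(1)[of "x - y" S]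
    by (simp add: abs_le_iff)
qed

lemma integrable_Zmat:
  assumes "prob_space D" and sets: "sets D = sets sketch_space"
  shows "integrable D (Zmat B)"
proof -
  interpret prob_space D by fact
  have "Zmat B \<in> borel_measurable D"
    using measurable_Zmat[OF B] measurable_cong_sets[OF sets refl] by blast
  moreover have "norm (Zmat B S) \<le> (\<Sum>b\<in>(Basis :: (real^'n^'n) set). onorm ((*v) B))" for S
  proof -
    have "norm (Zmat B S) \<le> (\<Sum>b\<in>Basis. \<bar>Zmat B S \<bullet> b\<bar>)" by (rule norm_le_l1)
    also have "\<dots> \<le> (\<Sum>b\<in>(Basis :: (real^'n^'n) set). onorm ((*v) B))"
    proof (rule sum_mono)
      fix b :: "real^'n^'n" assume "b \<in> Basis"
      then obtain i j where b: "b = axis i (axis j 1)" by (auto simp: Basis_vec_def)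
      have "Zmat B S \<bullet> b = axis i 1 \<bullet> (Zmat B S *v axis j 1)"
        by (simp add: b inner_axis inner_axis' matrix_vector_mul_component)
      then show "\<bar>Zmat B S \<bullet> b\<bar> \<le> onorm ((*v) B)"
        using Zmat_form_bounded[of "axis i 1" "axis j 1" S] by simp
    qed
    finally show ?thesis .
  qed
  ultimately show ?thesis by (intro integrable_const_bound[where B = "\<Sum>b\<in>(Basis :: (real^'n^'n) set). onorm ((*v) B)"]) auto
qed

lemma normsq_add_le: "normsq B (x + y) \<le> 2 * (normsq B x + normsq B y)"
  using normsq_add_scaleR[OF B, of x 1 y] normsq_add_scaleR[OF B, of x "-1" y]
    normsq_nonneg[OF B, of "x + (-1) *\<^sub>R y"] by simp

text \<open>
With \<open>t = \<theta>\<close> the left side is the squared error of the gradient estimate, split as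
\<open>(w - t P w) + t P v\<close>. The forms are written with \<open>t Z\<close> and \<open>t\<^sup>2 Z\<close> because these are the matrices
whose expectations are known.
\<close>
lemma gradient_estimate_bound:
  fixes t :: real and v w S
  defines "p \<equiv> \<lambda>y. matrix_inv B *v (Zmat B S *v y)"
  shows "normsq B (w + t *\<^sub>R p (v - w))
    \<le> 2 * (normsq B w - 2 * (w \<bullet> ((t *\<^sub>R Zmat B S) *v w)) + w \<bullet> ((t\<^sup>2 *\<^sub>R Zmat B S) *v w)
        + v \<bullet> ((t\<^sup>2 *\<^sub>R Zmat B S) *v v))"
proof -
  let ?a = "w + (- t) *\<^sub>R p w" and ?b = "t *\<^sub>R p v"
  have "w + t *\<^sub>R p (v - w) = ?a + ?b"
    by (simp add: p_def matrix_vector_mult_diff_distrib algebra_simps)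
  then have "normsq B (w + t *\<^sub>R p (v - w)) \<le> 2 * (normsq B ?a + normsq B ?b)"
    using normsq_add_le[of ?a ?b] by (simp only:)
  moreover have "normsq B ?a = normsq B w - 2 * t * (w \<bullet> (Zmat B S *v w)) + t\<^sup>2 * (w \<bullet> (Zmat B S *v w))"
    unfolding normsq_add_scaleR[OF B] p_def normsq_projection binner_projection by simp
  moreover have "normsq B ?b = t\<^sup>2 * (v \<bullet> (Zmat B S *v v))"
    using normsq_projection[of S v] unfolding p_def normsq_binner by (simp add: power2_eq_square)
  ultimately show ?thesis by (simp add: scaleR_matrix_vector_assoc[symmetric])
qed

text \<open>
Pythagoras for \<open>(I - P) w + P v\<close>.
\<close>
lemma shift_error:
  fixes v w S
  defines "p \<equiv> \<lambda>y. matrix_inv B *v (Zmat B S *v y)"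
  shows "normsq B (w + p (v - w)) = normsq B w - w \<bullet> (Zmat B S *v w) + v \<bullet> (Zmat B S *v v)"
proof -
  have "normsq B (w + p (v - w)) = normsq B (w + 1 *\<^sub>R p (v - w))" by simp
  also have "\<dots> = normsq B w + 2 * (w \<bullet> (Zmat B S *v (v - w))) + (v - w) \<bullet> (Zmat B S *v (v - w))"
    unfolding normsq_add_scaleR[OF B] p_def normsq_projection binner_projection by simp
  also have "\<dots> = normsq B w - w \<bullet> (Zmat B S *v w) + v \<bullet> (Zmat B S *v v)"
    using inner_Zmat[OF B, of w S v]
    by (simp add: matrix_vector_mult_diff_distrib inner_simps inner_commute)
  finally show ?thesis .
qed

end

text \<open>
The transition of the Markov chain formed by the states \<open>(x, h)\<close>.
\<close>
definition sega_step ::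
    "real^'n^'n \<Rightarrow> (real^'n \<Rightarrow> real) \<Rightarrow> (real^'n \<Rightarrow> ereal) \<Rightarrow> real \<Rightarrow> ('n sketch \<Rightarrow> real) \<Rightarrow>
      'n sketch \<Rightarrow> (real^'n) \<times> (real^'n) \<Rightarrow> (real^'n) \<times> (real^'n)" where
  "sega_step B f R \<alpha> \<theta> s z =
    (let u = matrix_inv B *v (Zmat B s *v (Bgrad B f (fst z) - snd z))
     in (prox B \<alpha> R (fst z - \<alpha> *\<^sub>R (snd z + \<theta> s *\<^sub>R u)), snd z + u))"

lemma sega_Suc: "sega B f R \<alpha> \<theta> x0 h0 S (Suc k) = sega_step B f R \<alpha> \<theta> (S k) (sega B f R \<alpha> \<theta> x0 h0 S k)"
  by (simp add: sega_step_def Let_def case_prod_beta)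

lemma normsq_matrix_simps:
  "normsq (A + A') x = normsq A x + normsq A' x"
  "normsq (A - A') x = normsq A x - normsq A' x"
  "normsq (c *\<^sub>R A) x = c * normsq A x"
  by (simp_all add: normsq_def matrix_vector_mult_add_rdistrib matrix_vector_mult_diff_rdistrib
      inner_simps scaleR_matrix_vector_assoc[symmetric])

lemma loewner_leD: "A \<preceq>\<^sub>L A' \<Longrightarrow> normsq A x \<le> normsq A' x"
  unfolding loewner_le_def pos_semidef_def normsq_def[symmetric] normsq_matrix_simps by simp

text \<open>
The deterministic data of the problem with the law of one sketch. The minimizer enters only through
its optimality condition.
\<close>
locale sega_setting = D: prob_space D
  for D :: "('n::finite) sketch measure" +
  fixes B Q C :: "real^'n^'n" and f :: "real^'n \<Rightarrow> real" and R :: "real^'n \<Rightarrow> ereal"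
    and \<mu> \<alpha> \<sigma> :: real and \<theta> :: "'n sketch \<Rightarrow> real" and xstar :: "real^'n"
  assumes B: "pos_def B" and Q: "pos_def Q"
    and smooth: "Q_smooth B Q f" and convex: "strongly_convex B \<mu> f"
    and R_range: "\<forall>x. R x \<noteq> -\<infinity>" and R_closed: "closed_fun R" and R_convex: "convex_fun R"
    and optimal: "is_subgradient B R xstar (- Bgrad B f xstar)"
    and D_sets: "sets D = sets sketch_space"
    and \<theta>_meas: "\<theta> \<in> borel_measurable D"
    and \<theta>_int: "integrable D (\<lambda>s. \<theta> s *\<^sub>R Zmat B s)"
    and \<theta>_mean: "(\<integral>s. \<theta> s *\<^sub>R Zmat B s \<partial>D) = B"
    and \<theta>2_int: "integrable D (\<lambda>s. (\<theta> s)\<^sup>2 *\<^sub>R Zmat B s)"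
    and C_def: "C = (\<integral>s. (\<theta> s)\<^sup>2 *\<^sub>R Zmat B s \<partial>D)"
    and \<alpha>: "\<alpha> > 0" and \<sigma>: "\<sigma> > 0"
    and step1: "\<alpha> *\<^sub>R (2 *\<^sub>R (C - B) + (\<sigma> * \<mu>) *\<^sub>R B) \<preceq>\<^sub>L \<sigma> *\<^sub>R (\<integral>s. Zmat B s \<partial>D)"
    and step2: "\<alpha> *\<^sub>R C \<preceq>\<^sub>L (1 / 2) *\<^sub>R (Q - \<sigma> *\<^sub>R (\<integral>s. Zmat B s \<partial>D))"
begin

abbreviation "step \<equiv> sega_step B f R \<alpha> \<theta>"
abbreviation "V \<equiv> lyapunov B f \<alpha> \<sigma> xstar"

lemma V_nonneg: "0 \<le> V z"
  using normsq_nonneg[OF B] \<alpha> \<sigma> by (simp add: lyapunov_def case_prod_beta)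

text \<open>
A pointwise upper bound for the Lyapunov function after one step that is affine in \<open>Z\<close>, \<open>\<theta> Z\<close> and
\<open>\<theta>\<^sup>2 Z\<close>, so that its expectation can be read off.
\<close>
definition step_bound :: "real^'n \<Rightarrow> real^'n \<Rightarrow> real^'n \<Rightarrow> 'n sketch \<Rightarrow> real" where
  "step_bound r v w s =
     normsq B r - 2 * \<alpha> * (binner B w r + r \<bullet> ((\<theta> s *\<^sub>R Zmat B s) *v (v - w)))
     + 2 * \<alpha>\<^sup>2 * (normsq B w - 2 * (w \<bullet> ((\<theta> s *\<^sub>R Zmat B s) *v w))
         + w \<bullet> (((\<theta> s)\<^sup>2 *\<^sub>R Zmat B s) *v w) + v \<bullet> (((\<theta> s)\<^sup>2 *\<^sub>R Zmat B s) *v v))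
     + \<sigma> * \<alpha> * (normsq B w - w \<bullet> (Zmat B s *v w) + v \<bullet> (Zmat B s *v v))"

lemma V_step_le:
  "V (step s (x, h)) \<le> step_bound (x - xstar) (Bgrad B f x - Bgrad B f xstar) (h - Bgrad B f xstar) s"
proof -
  define r v w where "r = x - xstar" and "v = Bgrad B f x - Bgrad B f xstar"
    and "w = h - Bgrad B f xstar"
  define p where "p y = matrix_inv B *v (Zmat B s *v y)" for y
  define e where "e = w + \<theta> s *\<^sub>R p (v - w)"
  have vw: "Bgrad B f x - h = v - w" by (simp add: v_def w_def)
  have "x - \<alpha> *\<^sub>R (h + \<theta> s *\<^sub>R p (v - w)) - (xstar + \<alpha> *\<^sub>R - Bgrad B f xstar) = r + (- \<alpha>) *\<^sub>R e"
    by (simp add: r_def e_def w_def algebra_simps)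
  then have "normsq B (fst (step s (x, h)) - xstar) \<le> normsq B (r + (- \<alpha>) *\<^sub>R e)"
    using prox_nonexpansive_subgradient[OF B R_closed R_convex R_range optimal \<alpha>,
        of "x - \<alpha> *\<^sub>R (h + \<theta> s *\<^sub>R p (v - w))"]
    by (simp add: sega_step_def Let_def vw p_def)
  also have "\<dots> = normsq B r - 2 * \<alpha> * binner B r e + \<alpha>\<^sup>2 * normsq B e"
    unfolding normsq_add_scaleR[OF B] by simp
  finally have 1: "normsq B (fst (step s (x, h)) - xstar)
      \<le> normsq B r - 2 * \<alpha> * binner B r e + \<alpha>\<^sup>2 * normsq B e" .
  have 2: "binner B r e = binner B w r + r \<bullet> ((\<theta> s *\<^sub>R Zmat B s) *v (v - w))"
    unfolding e_def p_def using binner_commute[OF B, of w r]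
    by (simp only: binner_simps(4,8) binner_projection[OF B] scaleR_matrix_vector_assoc[symmetric] inner_scaleR_right)
  have 3: "\<alpha>\<^sup>2 * normsq B e \<le> \<alpha>\<^sup>2 * (2 * (normsq B w - 2 * (w \<bullet> ((\<theta> s *\<^sub>R Zmat B s) *v w))
         + w \<bullet> (((\<theta> s)\<^sup>2 *\<^sub>R Zmat B s) *v w) + v \<bullet> (((\<theta> s)\<^sup>2 *\<^sub>R Zmat B s) *v v)))"
    unfolding e_def p_def by (intro mult_left_mono gradient_estimate_bound[OF B]) simp
  have "snd (step s (x, h)) - Bgrad B f xstar = w + p (v - w)"
    by (simp add: sega_step_def Let_def vw p_def w_def)
  then have 4: "normsq B (snd (step s (x, h)) - Bgrad B f xstar)
      = normsq B w - w \<bullet> (Zmat B s *v w) + v \<bullet> (Zmat B s *v v)"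
    by (simp only: p_def shift_error[OF B])
  have "V (step s (x, h)) = normsq B (fst (step s (x, h)) - xstar)
      + \<sigma> * \<alpha> * normsq B (snd (step s (x, h)) - Bgrad B f xstar)"
    by (simp add: lyapunov_def case_prod_beta)
  then show ?thesis
    using 1 2 3 unfolding 4 step_bound_def r_def[symmetric] v_def[symmetric] w_def[symmetric] 2
    by linarith
qed

lemmas Zmat_int = integrable_Zmat[OF B D.prob_space_axioms D_sets]

lemma step_bound_integral:
  "integrable D (step_bound r v w)"
  "(\<integral>s. step_bound r v w s \<partial>D) =
     normsq B r - 2 * \<alpha> * binner B v r
     + 2 * \<alpha>\<^sup>2 * (normsq C w - normsq B w + normsq C v)
     + \<sigma> * \<alpha> * (normsq B w - normsq (\<integral>s. Zmat B s \<partial>D) w + normsq (\<integral>s. Zmat B s \<partial>D) v)"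
proof -
  note int = integral_matrix_form(1)[OF \<theta>_int] integral_matrix_form(1)[OF \<theta>2_int] integral_matrix_form(1)[OF Zmat_int]
  show "integrable D (step_bound r v w)"
    unfolding step_bound_def[abs_def] by (intro Bochner_Integration.integrable_add Bochner_Integration.integrable_diff integrable_mult_right int D.integrable_const)
  have "binner B w r + r \<bullet> (B *v (v - w)) = binner B v r"
    unfolding binner_def[of B r "v - w", symmetric] using binner_commute[OF B, of r v] binner_commute[OF B, of r w] by simp
  moreover have "(\<integral>s. step_bound r v w s \<partial>D) =
     normsq B r - 2 * \<alpha> * (binner B w r + r \<bullet> (B *v (v - w)))
     + 2 * \<alpha>\<^sup>2 * (normsq B w - 2 * (w \<bullet> (B *v w)) + w \<bullet> (C *v w) + v \<bullet> (C *v v))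
     + \<sigma> * \<alpha> * (normsq B w - w \<bullet> ((\<integral>s. Zmat B s \<partial>D) *v w) + v \<bullet> ((\<integral>s. Zmat B s \<partial>D) *v v))"
    unfolding step_bound_def
    by (simp add: int integral_matrix_form(2)[OF \<theta>_int] integral_matrix_form(2)[OF \<theta>2_int]
        integral_matrix_form(2)[OF Zmat_int] \<theta>_mean C_def[symmetric] D.prob_space)
  ultimately show "(\<integral>s. step_bound r v w s \<partial>D) =
     normsq B r - 2 * \<alpha> * binner B v r
     + 2 * \<alpha>\<^sup>2 * (normsq C w - normsq B w + normsq C v)
     + \<sigma> * \<alpha> * (normsq B w - normsq (\<integral>s. Zmat B s \<partial>D) w + normsq (\<integral>s. Zmat B s \<partial>D) v)"
    by (simp add: normsq_def)
qed

text \<open>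
The three inequalities in the proof are the first stepsize condition at \<open>w\<close>, the second one at \<open>v\<close>
and the monotonicity of the gradient at \<open>r\<close>; added with the weights \<open>\<alpha>\<close>, \<open>2 \<alpha>\<close> and \<open>2 \<alpha>\<close> they
cancel everything except the multiple of the Lyapunov function.
\<close>
lemma step_bound_contracts:
  "(\<integral>s. step_bound (x - xstar) (Bgrad B f x - Bgrad B f xstar) (h - Bgrad B f xstar) s \<partial>D)
    \<le> (1 - \<alpha> * \<mu>) * V (x, h)"
proof -
  define r v w where "r = x - xstar" and "v = Bgrad B f x - Bgrad B f xstar"
    and "w = h - Bgrad B f xstar"
  let ?EZ = "\<integral>s. Zmat B s \<partial>D"
  have "\<alpha> * (\<alpha> * (2 * (normsq C w - normsq B w) + \<sigma> * \<mu> * normsq B w)) \<le> \<alpha> * (\<sigma> * normsq ?EZ w)"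
    using loewner_leD[OF step1, of w] \<alpha> by (simp add: normsq_matrix_simps)
  moreover have "2 * \<alpha> * (\<alpha> * normsq C v) \<le> 2 * \<alpha> * (1 / 2 * (normsq Q v - \<sigma> * normsq ?EZ v))"
    using loewner_leD[OF step2, of v] \<alpha> by (simp add: normsq_matrix_simps)
  moreover have "2 * \<alpha> * (\<mu> / 2 * normsq B r + 1 / 2 * normsq Q v) \<le> 2 * \<alpha> * binner B v r"
    using smooth_strongly_convex_monotone[OF smooth convex, of x xstar] \<alpha>
    by (intro mult_left_mono) (simp_all add: r_def v_def)
  moreover have "V (x, h) = normsq B r + \<sigma> * \<alpha> * normsq B w"
    by (simp add: lyapunov_def r_def w_def)
  ultimately show ?thesis
    unfolding step_bound_integral r_def[symmetric] v_def[symmetric] w_def[symmetric]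
    by (simp add: algebra_simps power2_eq_square)
qed

text \<open>
Stated for the nonnegative integral, in which the steps can be chained before integrability of the
Lyapunov function along the iterates is known.
\<close>
lemma expected_step:
  "(\<integral>\<^sup>+s. ennreal (V (step s z)) \<partial>D) \<le> ennreal ((1 - \<alpha> * \<mu>) * V z)"
proof -
  obtain x h where z: "z = (x, h)" by (cases z)
  let ?U = "step_bound (x - xstar) (Bgrad B f x - Bgrad B f xstar) (h - Bgrad B f xstar)"
  have "(\<integral>\<^sup>+s. ennreal (V (step s z)) \<partial>D) \<le> (\<integral>\<^sup>+s. ennreal (?U s) \<partial>D)"
    unfolding z by (intro nn_integral_mono ennreal_leI V_step_le)
  also have "\<dots> = ennreal (\<integral>s. ?U s \<partial>D)"
    using V_nonneg V_step_le order_trans by (intro nn_integral_eq_integral step_bound_integral AE_I2) blast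
  also have "\<dots> \<le> ennreal ((1 - \<alpha> * \<mu>) * V z)"
    unfolding z by (intro ennreal_leI step_bound_contracts)
  finally show ?thesis .
qed

text \<open>
The stepsize conditions force \<open>\<alpha> \<mu> \<le> 1\<close>: the Lyapunov function is nonnegative after a step and
positive at some state before it.
\<close>
lemma contraction_factor_nonneg: "0 \<le> 1 - \<alpha> * \<mu>"
proof -
  define x where "x = xstar + axis undefined 1"
  define h where "h = Bgrad B f xstar"
  have "x - xstar \<noteq> 0" by (simp add: x_def)
  then have "0 < normsq B (x - xstar)" using B unfolding pos_def_def normsq_def by blast
  then have pos: "0 < V (x, h)" by (simp add: lyapunov_def h_def normsq_def)
  have "0 \<le> (\<integral>s. step_bound (x - xstar) (Bgrad B f x - Bgrad B f xstar) (h - Bgrad B f xstar) s \<partial>D)"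
    using V_nonneg V_step_le order_trans by (intro integral_nonneg_AE AE_I2) blast
  then have "0 \<le> (1 - \<alpha> * \<mu>) * V (x, h)" using step_bound_contracts order_trans by blast
  then show ?thesis using pos by (simp add: zero_le_mult_iff)
qed

end

section \<open>The random iterates\<close>

context sega_setting
begin

lemma measurable_step: "(\<lambda>(z, s). step s z) \<in> borel \<Otimes>\<^sub>M sketch_space \<rightarrow>\<^sub>M borel"
proof -
  let ?N = "borel \<Otimes>\<^sub>M sketch_space :: (((real^'n) \<times> (real^'n)) \<times> 'n sketch) measure"
  have [measurable]: "\<theta> \<in> borel_measurable sketch_space"
    using \<theta>_meas measurable_cong_sets[OF D_sets refl] by blast
  have [measurable]: "fst \<in> (borel :: ((real^'n) \<times> (real^'n)) measure) \<rightarrow>\<^sub>M borel"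
    "snd \<in> (borel :: ((real^'n) \<times> (real^'n)) measure) \<rightarrow>\<^sub>M borel"
    by (auto intro!: borel_measurable_continuous_onI continuous_intros)
  have [measurable]: "Bgrad B f \<in> borel_measurable borel"
    by (rule borel_measurable_continuous_onI[OF continuous_Bgrad[OF Q smooth]])
  have [measurable]: "prox B \<alpha> R \<in> borel_measurable borel"
    by (rule borel_measurable_continuous_onI[OF continuous_prox[OF B R_closed R_convex R_range optimal \<alpha>]])
  have [measurable]: "(\<lambda>p. Zmat B (snd p) *v (Bgrad B f (fst (fst p)) - snd (fst p))) \<in> borel_measurable ?N"
    by (intro measurable_Zmat_mult[OF B]) measurable
  show ?thesis
    unfolding sega_step_def Let_def case_prod_beta by measurable
qed

lemma measurable_V: "V \<in> borel_measurable borel"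
proof -
  have [measurable]: "fst \<in> (borel :: ((real^'n) \<times> (real^'n)) measure) \<rightarrow>\<^sub>M borel"
    "snd \<in> (borel :: ((real^'n) \<times> (real^'n)) measure) \<rightarrow>\<^sub>M borel"
    by (auto intro!: borel_measurable_continuous_onI continuous_intros)
  show ?thesis unfolding lyapunov_def normsq_binner case_prod_beta by measurable
qed

end

text \<open>
The state after \<open>k\<close> steps is a function of the first \<open>k\<close> sketches.
\<close>
lemma sega_cong:
  "(\<And>i. i < k \<Longrightarrow> S i = S' i) \<Longrightarrow> sega B f R \<alpha> \<theta> x0 h0 S k = sega B f R \<alpha> \<theta> x0 h0 S' k"
  by (induction k) auto

locale sega_run = sega_setting D B Q C f R \<mu> \<alpha> \<sigma> \<theta> xstar + M: prob_space M
  for D :: "('n::finite) sketch measure" and B Q C f R \<mu> \<alpha> \<sigma> \<theta> xstar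
    and M :: "'w measure" +
  fixes S :: "nat \<Rightarrow> 'w \<Rightarrow> 'n sketch" and x0 h0 :: "real^'n"
  assumes S_indep: "M.indep_vars (\<lambda>_. sketch_space) S UNIV"
    and S_distr: "\<And>k. distr M sketch_space (S k) = D"
begin

abbreviation "iterate k xs \<equiv> sega B f R \<alpha> \<theta> x0 h0 xs k"

lemma measurable_iterate: "iterate k \<in> (\<Pi>\<^sub>M i\<in>{..<k}. sketch_space) \<rightarrow>\<^sub>M borel"
proof (induction k)
  case (Suc k)
  have "(\<lambda>xs. iterate k (restrict xs {..<k})) \<in> (\<Pi>\<^sub>M i\<in>{..<Suc k}. sketch_space) \<rightarrow>\<^sub>M borel"
    by (rule measurable_compose[OF measurable_restrict_subset Suc.IH]) auto
  also have "(\<lambda>xs. iterate k (restrict xs {..<k})) = iterate k"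
    by (intro ext sega_cong) simp
  finally have "(\<lambda>xs. (iterate k xs, xs k)) \<in> (\<Pi>\<^sub>M i\<in>{..<Suc k}. sketch_space) \<rightarrow>\<^sub>M borel \<Otimes>\<^sub>M sketch_space"
    by (rule measurable_Pair) (rule measurable_component_singleton, simp)
  from measurable_compose[OF this measurable_step] show ?case
    by (simp only: sega_Suc case_prod_conv)
qed simp

text \<open>
The state after \<open>k\<close> steps is independent of the next sketch. Independence of the blocks \<open>{..<k}\<close>
and \<open>{k}\<close> of sketches says that their joint law is a product, and the product law is pushed forward
along the map to the state and the evaluation at \<open>k\<close>.
\<close>
lemma iterate_sketch_distr:
  defines "Y \<equiv> \<lambda>k \<omega>. iterate k (\<lambda>i. S i \<omega>)"
  shows "Y k \<in> M \<rightarrow>\<^sub>M borel" "S k \<in> M \<rightarrow>\<^sub>M sketch_space"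
    "distr M (borel \<Otimes>\<^sub>M sketch_space) (\<lambda>\<omega>. (Y k \<omega>, S k \<omega>)) = distr M borel (Y k) \<Otimes>\<^sub>M D"
proof -
  let ?P = "\<lambda>I. \<Pi>\<^sub>M i\<in>I. (sketch_space :: 'n sketch measure)"
  let ?X = "\<lambda>I \<omega>. restrict (\<lambda>i. S i \<omega>) I"
  have "M.indep_var (?P {..<k}) (?X {..<k}) (?P {k}) (?X {k})"
    by (rule M.indep_var_restrict[OF S_indep]) auto
  from this[unfolded M.indep_var_distribution_eq]
  have X: "?X {..<k} \<in> M \<rightarrow>\<^sub>M ?P {..<k}" "?X {k} \<in> M \<rightarrow>\<^sub>M ?P {k}"
    and pair: "distr M (?P {..<k}) (?X {..<k}) \<Otimes>\<^sub>M distr M (?P {k}) (?X {k})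
      = distr M (?P {..<k} \<Otimes>\<^sub>M ?P {k}) (\<lambda>\<omega>. (?X {..<k} \<omega>, ?X {k} \<omega>))" by auto
  have comp: "(\<lambda>xs. xs k) \<in> ?P {k} \<rightarrow>\<^sub>M sketch_space"
    by (rule measurable_component_singleton) simp
  have Y_eq: "(\<lambda>\<omega>. iterate k (?X {..<k} \<omega>)) = Y k"
    unfolding Y_def by (intro ext sega_cong) simp
  have S_eq: "(\<lambda>\<omega>. ?X {k} \<omega> k) = S k" by simp
  show "Y k \<in> M \<rightarrow>\<^sub>M borel"
    using measurable_compose[OF X(1) measurable_iterate] unfolding Y_eq .
  show "S k \<in> M \<rightarrow>\<^sub>M sketch_space"
    using measurable_compose[OF X(2) comp] unfolding S_eq .
  have dY: "distr (distr M (?P {..<k}) (?X {..<k})) borel (iterate k) = distr M borel (Y k)"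
    using distr_distr[OF measurable_iterate X(1)] unfolding comp_def Y_eq .
  have dS: "distr (distr M (?P {k}) (?X {k})) sketch_space (\<lambda>xs. xs k) = D"
    using distr_distr[OF comp X(2)] unfolding comp_def S_eq S_distr .
  have "distr M borel (Y k) \<Otimes>\<^sub>M D = distr (distr M (?P {..<k}) (?X {..<k}) \<Otimes>\<^sub>M distr M (?P {k}) (?X {k}))
      (borel \<Otimes>\<^sub>M sketch_space) (\<lambda>(xs, ys). (iterate k xs, ys k))"
    unfolding dY[symmetric] dS[symmetric]
    by (rule pair_measure_distr)
      (use measurable_iterate[of k] comp D.sigma_finite_measure_axioms in \<open>simp_all add: dS\<close>)
  also have "\<dots> = distr M (borel \<Otimes>\<^sub>M sketch_space)
      ((\<lambda>(xs, ys). (iterate k xs, ys k)) \<circ> (\<lambda>\<omega>. (?X {..<k} \<omega>, ?X {k} \<omega>)))"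
    unfolding pair
  proof (rule distr_distr)
    show "(\<lambda>(xs, ys). (iterate k xs, ys k)) \<in> ?P {..<k} \<Otimes>\<^sub>M ?P {k} \<rightarrow>\<^sub>M borel \<Otimes>\<^sub>M sketch_space"
      unfolding case_prod_beta
      by (intro measurable_Pair measurable_compose[OF measurable_fst measurable_iterate]
          measurable_compose[OF measurable_snd comp])
    show "(\<lambda>\<omega>. (?X {..<k} \<omega>, ?X {k} \<omega>)) \<in> M \<rightarrow>\<^sub>M ?P {..<k} \<Otimes>\<^sub>M ?P {k}"
      by (rule measurable_Pair[OF X])
  qed
  also have "(\<lambda>(xs, ys). (iterate k xs, ys k)) \<circ> (\<lambda>\<omega>. (?X {..<k} \<omega>, ?X {k} \<omega>)) = (\<lambda>\<omega>. (Y k \<omega>, S k \<omega>))"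
    unfolding Y_eq[symmetric] by auto
  finally show "distr M (borel \<Otimes>\<^sub>M sketch_space) (\<lambda>\<omega>. (Y k \<omega>, S k \<omega>)) = distr M borel (Y k) \<Otimes>\<^sub>M D" ..
qed

text \<open>
Conditioning on the current state, by Tonelli's theorem for the product law of state and sketch.
\<close>
lemma expected_V_Suc:
  "(\<integral>\<^sup>+\<omega>. ennreal (V (iterate (Suc k) (\<lambda>i. S i \<omega>))) \<partial>M)
    \<le> ennreal (1 - \<alpha> * \<mu>) * (\<integral>\<^sup>+\<omega>. ennreal (V (iterate k (\<lambda>i. S i \<omega>))) \<partial>M)"
proof -
  define Y where "Y \<omega> = iterate k (\<lambda>i. S i \<omega>)" for \<omega>
  have Y: "Y \<in> M \<rightarrow>\<^sub>M borel" and Sk: "S k \<in> M \<rightarrow>\<^sub>M sketch_space"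
    and pair: "distr M borel Y \<Otimes>\<^sub>M D = distr M (borel \<Otimes>\<^sub>M sketch_space) (\<lambda>\<omega>. (Y \<omega>, S k \<omega>))"
    using iterate_sketch_distr[of k] by (simp_all add: Y_def[abs_def])
  note [measurable] = Y Sk
  have meas: "(\<lambda>p. ennreal (V (case p of (z, s) \<Rightarrow> step s z))) \<in> borel_measurable (borel \<Otimes>\<^sub>M sketch_space)"
    using measurable_compose[OF measurable_step measurable_V] by simp
  have meas': "(\<lambda>p. ennreal (V (case p of (z, s) \<Rightarrow> step s z))) \<in> borel_measurable (distr M borel Y \<Otimes>\<^sub>M D)"
    unfolding pair using meas by simp
  have measV: "(\<lambda>z. ennreal (V z)) \<in> borel_measurable borel" using measurable_V by simp
  have "(\<integral>\<^sup>+\<omega>. ennreal (V (iterate (Suc k) (\<lambda>i. S i \<omega>))) \<partial>M)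
      = (\<integral>\<^sup>+\<omega>. ennreal (V (case (Y \<omega>, S k \<omega>) of (z, s) \<Rightarrow> step s z)) \<partial>M)"
    by (simp only: sega_Suc Y_def case_prod_conv)
  also have "\<dots> = (\<integral>\<^sup>+p. ennreal (V (case p of (z, s) \<Rightarrow> step s z))
      \<partial>distr M (borel \<Otimes>\<^sub>M sketch_space) (\<lambda>\<omega>. (Y \<omega>, S k \<omega>)))"
    by (subst nn_integral_distr) (use meas in \<open>simp_all add: measurable_Pair[OF Y Sk]\<close>)
  also have "\<dots> = (\<integral>\<^sup>+z. \<integral>\<^sup>+s. ennreal (V (step s z)) \<partial>D \<partial>distr M borel Y)"
    unfolding pair[symmetric] using D.nn_integral_fst[OF meas'] by simp
  also have "\<dots> \<le> (\<integral>\<^sup>+z. ennreal (1 - \<alpha> * \<mu>) * ennreal (V z) \<partial>distr M borel Y)"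
    using expected_step contraction_factor_nonneg V_nonneg
    by (intro nn_integral_mono) (simp add: ennreal_mult)
  also have "\<dots> = ennreal (1 - \<alpha> * \<mu>) * (\<integral>\<^sup>+z. ennreal (V z) \<partial>distr M borel Y)"
    using measV by (intro nn_integral_cmult) simp
  also have "(\<integral>\<^sup>+z. ennreal (V z) \<partial>distr M borel Y) = (\<integral>\<^sup>+\<omega>. ennreal (V (Y \<omega>)) \<partial>M)"
    using measV by (intro nn_integral_distr[OF Y]) simp
  finally show ?thesis by (simp only: Y_def)
qed

lemma expected_V_geometric:
  "(\<integral>\<^sup>+\<omega>. ennreal (V (iterate k (\<lambda>i. S i \<omega>))) \<partial>M) \<le> ennreal ((1 - \<alpha> * \<mu>) ^ k * V (x0, h0))"
proof (induction k)
  case 0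
  show ?case by (simp add: M.emeasure_space_1)
next
  case (Suc k)
  have "(\<integral>\<^sup>+\<omega>. ennreal (V (iterate (Suc k) (\<lambda>i. S i \<omega>))) \<partial>M)
      \<le> ennreal (1 - \<alpha> * \<mu>) * ennreal ((1 - \<alpha> * \<mu>) ^ k * V (x0, h0))"
    using expected_V_Suc[of k] Suc.IH by (meson mult_left_mono order_trans zero_le)
  then show ?case
    using contraction_factor_nonneg V_nonneg by (simp add: ennreal_mult[symmetric] mult_ac)
qed

lemma V_integrable_and_geometric:
  "integrable M (\<lambda>\<omega>. V (iterate k (\<lambda>i. S i \<omega>)))"
  "(\<integral>\<omega>. V (iterate k (\<lambda>i. S i \<omega>)) \<partial>M) \<le> (1 - \<alpha> * \<mu>) ^ k * V (x0, h0)"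
proof -
  have "(\<lambda>\<omega>. iterate k (\<lambda>i. S i \<omega>)) \<in> M \<rightarrow>\<^sub>M borel"
    by (rule iterate_sketch_distr(1))
  from measurable_compose[OF this measurable_V]
  have meas: "(\<lambda>\<omega>. V (iterate k (\<lambda>i. S i \<omega>))) \<in> borel_measurable M" .
  show int: "integrable M (\<lambda>\<omega>. V (iterate k (\<lambda>i. S i \<omega>)))"
    using expected_V_geometric[of k] V_nonneg
    by (intro integrableI_nonneg[OF meas]) (auto simp: less_top[symmetric] top_unique)
  have "ennreal (\<integral>\<omega>. V (iterate k (\<lambda>i. S i \<omega>)) \<partial>M) \<le> ennreal ((1 - \<alpha> * \<mu>) ^ k * V (x0, h0))"
    using expected_V_geometric[of k] nn_integral_eq_integral[OF int] V_nonneg by simp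
  then show "(\<integral>\<omega>. V (iterate k (\<lambda>i. S i \<omega>)) \<partial>M) \<le> (1 - \<alpha> * \<mu>) ^ k * V (x0, h0)"
    using contraction_factor_nonneg V_nonneg by (simp add: ennreal_le_iff)
qed

end

theorem theorem3p3:
  fixes B Q C :: "real^'n^'n"
    and f :: "real^'n \<Rightarrow> real" and R F :: "real^'n \<Rightarrow> ereal"
    and \<mu> \<alpha> \<sigma> :: real
    and D :: "'n sketch measure" and \<theta> :: "'n sketch \<Rightarrow> real"
    and M :: "'w measure" and S :: "nat \<Rightarrow> 'w \<Rightarrow> 'n sketch"
    and x0 h0 xstar :: "real^'n"
  assumes B: "pos_def B" and Q: "pos_def Q"
    and f_diff: "\<forall>x. f differentiable (at x)"
    and f_smooth: "Q_smooth B Q f"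
    and \<mu>: "\<mu> > 0" and f_convex: "strongly_convex B \<mu> f"
    and R_range: "\<forall>x. R x \<noteq> -\<infinity>" and R_closed: "closed_fun R" and R_convex: "convex_fun R"
    and F_def: "\<forall>x. F x = ereal (f x) + R x"
    and D_prob: "prob_space D" and D_sets: "sets D = sets sketch_space"
    and \<theta>_meas: "\<theta> \<in> borel_measurable D"
    and \<theta>_int: "integrable D (\<lambda>s. \<theta> s *\<^sub>R Zmat B s)"
    and \<theta>_mean: "(\<integral>s. \<theta> s *\<^sub>R Zmat B s \<partial>D) = B"
    and \<theta>2_int: "integrable D (\<lambda>s. (\<theta> s)\<^sup>2 *\<^sub>R Zmat B s)"
    and C_def: "C = (\<integral>s. (\<theta> s)\<^sup>2 *\<^sub>R Zmat B s \<partial>D)"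
    and \<alpha>: "\<alpha> > 0" and \<sigma>: "\<sigma> > 0"
    and step1: "\<alpha> *\<^sub>R (2 *\<^sub>R (C - B) + (\<sigma> * \<mu>) *\<^sub>R B) \<preceq>\<^sub>L \<sigma> *\<^sub>R (\<integral>s. Zmat B s \<partial>D)"
    and step2: "\<alpha> *\<^sub>R C \<preceq>\<^sub>L (1 / 2) *\<^sub>R (Q - \<sigma> *\<^sub>R (\<integral>s. Zmat B s \<partial>D))"
    and M_prob: "prob_space M"
    and S_indep: "prob_space.indep_vars M (\<lambda>_. sketch_space) S UNIV"
    and S_distr: "\<forall>k. distr M sketch_space (S k) = D"
    and x0: "x0 \<in> eff_dom F" and h0: "h0 \<in> eff_dom F"
    and xstar: "is_arg_min F (\<lambda>_. True) xstar"
  defines "\<Phi> \<equiv> (\<lambda>k \<omega>. lyapunov B f \<alpha> \<sigma> xstar (sega B f R \<alpha> \<theta> x0 h0 (\<lambda>i. S i \<omega>) k))"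
  shows "\<forall>k. integrable M (\<Phi> k) \<and>
    (\<integral>\<omega>. \<Phi> k \<omega> \<partial>M) \<le> (1 - \<alpha> * \<mu>) ^ k * lyapunov B f \<alpha> \<sigma> xstar (x0, h0)"
proof -
  have F_min: "F xstar \<le> F y" for y using xstar by (auto simp: is_arg_min_def not_less)
  have "F x0 \<noteq> \<infinity>" using x0 by (simp add: eff_dom_def)
  then have "F xstar \<noteq> \<infinity>" using F_min[of x0] by auto
  then have R_fin: "R xstar \<noteq> \<infinity>" using F_def by simp
  have optimal: "is_subgradient B R xstar (- Bgrad B f xstar)"
    by (rule minimizer_subgradient[OF R_convex R_range R_fin Bgrad_derivative[OF B]])
      (use f_diff F_min F_def in auto)
  interpret D: prob_space D by (rule D_prob)
  interpret M: prob_space M by (rule M_prob)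
  interpret sega_run D B Q C f R \<mu> \<alpha> \<sigma> \<theta> xstar M S x0 h0
    by unfold_locales (fact assms optimal | use S_distr in simp)+
  show ?thesis
    unfolding \<Phi>_def using V_integrable_and_geometric by blast
qed

end
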